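(* The centralizer of $T$ is reduced to the powers of $T$: if $S:X\to X$ is a measurable map preserving $\mu$ and satisfying $S\circ T=T\circ S$ $\mu$-almost everywhere, then there exists $k\in\mathbb{Z}$ such that $S=T^k$ $\mu$-almost everywhere.
   Context: Construction of $T$ (Chacon infinite transformation). Let $X=\mathbb{R}_+=[0,\infty)$ with its Borel $\sigma$-algebra $\mathcal{A}$ and Lebesgue measure $\mu$. Tower $0$ is the single interval $[0,1)$, of height $h_0=1$. For $n\ge0$, given tower $n$, a stack of $h_n$ disjoint intervals (called levels) of length $3^{-n}$, each closed on the left and open on the right, step $n+1$ is: cut tower $n$ vertically into three subcolumns of equal width (first, second, third from left to right); put one extra interval of length $3^{-(n+1)}$ above the second (middle) subcolumn and $3h_n+1$ extra intervals of length $3^{-(n+1)}$ above the third subcolumn (extra intervals are picked successively, each time taking the leftmost interval of the desired length in the unused part of $\mathbb{R}_+$); then stack the three subcolumns, left under right, to get tower $n+1$, of height $h_{n+1}=2(3h_n+1)$. In each tower, $T$ maps each point not in the top level to the point exactly above it. This defines $T:X\to X$, which preserves $\mu$; it is injective with image $X\setminus\{0\}$, hence invertible modulo $\mu$-null sets, so that $T^k$ is defined $\mu$-a.e. for $k\in\mathbb{Z}$. *)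

theory Defs
  imports "HOL-Analysis.Analysis"
begin

definition chacon_measure :: "real measure" where
  "chacon_measure = restrict_space lborel {0..}"

text \<open>Left endpoint of the leftmost interval \<open>[a, a + w)\<close> of the half-line that avoids the
  set \<open>U\<close> of points already used.\<close>

definition leftmost_unused :: "real set \<Rightarrow> real \<Rightarrow> real" where
  "leftmost_unused U w = (LEAST a. 0 \<le> a \<and> {a..<a + w} \<inter> U = {})"

primrec pick_intervals :: "nat \<Rightarrow> real \<Rightarrow> real set \<Rightarrow> real list" where
  "pick_intervals 0 w U = []"
| "pick_intervals (Suc m) w U =
     (let a = leftmost_unused U w in a # pick_intervals m w (U \<union> {a..<a + w}))"

text \<open>A tower is the list, from bottom to top, of the left endpoints of its levels; the levels of
  \<open>tower n\<close> all have length \<open>1 / 3 ^ n\<close>. Among the \<open>3 h + 2\<close> new intervals of a step, the one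
  picked first goes above the middle subcolumn and the others go, in the order in which they are
  picked, from bottom to top above the third subcolumn.\<close>

primrec tower :: "nat \<Rightarrow> real list" where
  "tower 0 = [0]"
| "tower (Suc n) =
     (let L = tower n;
          w = 1 / 3 ^ Suc n;
          E = pick_intervals (1 + (3 * length L + 1)) w (\<Union>a\<in>set L. {a..<a + 1 / 3 ^ n})
      in L @ (map (\<lambda>a. a + w) L @ [hd E]) @ (map (\<lambda>a. a + 2 * w) L @ tl E))"

definition level :: "nat \<Rightarrow> nat \<Rightarrow> real set" where
  "level n i = {tower n ! i..<tower n ! i + 1 / 3 ^ n}"

text \<open>Only the values on \<open>{0..}\<close> are meaningful.\<close>

definition chacon :: "real \<Rightarrow> real" where
  "chacon x = (THE y. \<exists>n i. Suc i < length (tower n) \<and> x \<in> level n i \<and>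
                 y = tower n ! Suc i + (x - tower n ! i))"

text \<open>The image of \<open>{0..}\<close> under \<open>chacon\<close> is \<open>{0<..}\<close>, so a negative power has a meaningful
  value except on finitely many points of the forward orbit of \<open>0\<close>.\<close>

definition chacon_power :: "int \<Rightarrow> real \<Rightarrow> real" where
  "chacon_power k =
     (if 0 \<le> k then chacon ^^ nat k else inv_into {0..} chacon ^^ nat (- k))"

end

theory Submission
  imports Defs
begin

text \<open>
  Write \<open>T\<close> for \<^const>\<open>chacon\<close> and \<open>h n\<close> for the height of tower \<open>n\<close>, so that \<open>h (n + 1) = 6 h n + 2\<close>.
  The levels of tower \<open>n\<close> are the triadic intervals of length \<open>1 / 3 ^ n\<close> in an initial segment of
  the half-line, listed in some order. Passing from tower \<open>n\<close> to tower \<open>n + 1\<close>, a point at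
  position \<open>i\<close> moves to position \<open>i + shift n d\<close>, where \<open>d\<close> is its next ternary digit and
  \<open>shift n d\<close> is \<open>0\<close>, \<open>h n\<close> or \<open>2 h n + 1\<close>. So if two points of \<open>[0, 1)\<close>, or of a common level of
  tower \<open>n\<close>, differ by the power \<open>T ^ k\<close>, then \<open>k\<close> is the sum, over the places \<open>j\<close>, of the
  differences of the shifts of their digits. Since \<open>4 h i + 2\<close> summed over \<open>i < j\<close> stays below \<open>h j\<close>,
  two such expansions of the same \<open>k\<close> agree place by place (\<open>sparse_sum_eq_0\<close>), provided that no
  place confuses \<open>h j\<close> (digit \<open>0\<close> to \<open>1\<close>) with \<open>h j + 1\<close> (digit \<open>1\<close> to \<open>2\<close>).

  Let \<open>S\<close> commute with \<open>T\<close>. The set \<open>F\<close> of points that \<open>S\<close> sends to \<open>[0, 1)\<close> has measure one, hence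
  it fills more than four fifths of some level \<open>I\<close> of some tower \<open>n\<close> (\<open>dense_level\<close>). Take \<open>y\<close> in \<open>I\<close>
  and exchange the digits \<open>0\<close> and \<open>2\<close> of \<open>y\<close> at all places from \<open>n\<close> up to some bound. This
  preserves the measure, and the new point \<open>y'\<close> is a power \<open>T ^ k\<close> of \<open>y\<close>, so \<open>S y'\<close> is the same power
  of \<open>S y\<close>. If \<open>y\<close> and \<open>y'\<close> are both in \<open>F\<close>, then \<open>k\<close> has one expansion from \<open>y, y'\<close> and one from
  \<open>S y, S y'\<close>. The first has only the terms \<open>0\<close> and \<open>2 h j + 1\<close> up to sign, so no confusion is
  possible, and \<open>S y\<close> has the same digit as \<open>y\<close> wherever that digit was changed. As the number of
  exchanged places does not enter the measure of the exceptional set, \<open>S y\<close> agrees with \<open>y\<close> at all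
  places from \<open>n\<close> on where \<open>y\<close> has a digit other than \<open>1\<close>, unless \<open>y\<close> is in an exceptional set of
  measure at most twice that of \<open>I - F\<close>. This knowledge in turn excludes the confusion when
  the digits \<open>0\<close> and \<open>1\<close> are exchanged instead, which settles the digit \<open>1\<close> at the price of doubling
  the exceptional set again (\<open>agreement_on_nonnull_set\<close>).

  Two points of tower \<open>n\<close> with the same digits from place \<open>n\<close> on have the same offset in their
  levels, so they are on the same orbit. Therefore \<open>T ^ p (S y) = T ^ q y\<close> with fixed \<open>p\<close> and \<open>q\<close>
  holds on a set of positive measure. That set is invariant under \<open>T\<close>, and \<open>T\<close> is ergodic
  (\<open>chacon_ergodic\<close>), so the equation holds almost everywhere.
\<close>

section \<open>The levels of the towers\<close>

abbreviation height :: "nat \<Rightarrow> nat" where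
  "height n \<equiv> length (tower n)"

lemma leftmost_unused_initial:
  assumes "0 \<le> c" "0 < w"
  shows "leftmost_unused {0..<c} w = c"
  unfolding leftmost_unused_def
proof (rule Least_equality)
  show "0 \<le> c \<and> {c..<c + w} \<inter> {0..<c} = {}"
    using assms by auto
next
  fix a assume a: "0 \<le> a \<and> {a..<a + w} \<inter> {0..<c} = {}"
  show "c \<le> a"
  proof (rule ccontr)
    assume "\<not> c \<le> a"
    with a assms have "a \<in> {a..<a + w} \<inter> {0..<c}" by auto
    with a show False by blast
  qed
qed

lemma pick_intervals_initial:
  assumes "0 \<le> c" "0 < w"
  shows "pick_intervals m w {0..<c} = map (\<lambda>j. c + real j * w) [0..<m]"
  using assms(1)
proof (induction m arbitrary: c)
  case 0
  then show ?case by simp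
next
  case (Suc m)
  have "{0..<c} \<union> {c..<c + w} = {0..<c + w}"
    using Suc.prems assms(2) by auto
  moreover have "pick_intervals m w {0..<c + w} = map (\<lambda>j. (c + w) + real j * w) [0..<m]"
    using Suc.prems assms(2) by (intro Suc.IH) auto
  moreover have "map (\<lambda>j. (c + w) + real j * w) [0..<m] = map (\<lambda>j. c + real j * w) [Suc 0..<Suc m]"
    by (subst map_Suc_upt [symmetric]) (simp add: algebra_simps)
  ultimately show ?case
    using leftmost_unused_initial [OF Suc.prems assms(2)]
    by (simp add: Let_def upt_conv_Cons del: upt_Suc)
qed

lemma length_pick_intervals [simp]: "length (pick_intervals m w U) = m"
  by (induction m arbitrary: U) (auto simp: Let_def)

lemma height_Suc: "height (Suc n) = 6 * height n + 2"
  by (simp add: Let_def)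

lemma height_pos: "0 < height n"
  by (induction n) (simp_all add: height_Suc del: tower.simps(2))

text \<open>The total length of tower \<open>n\<close> grows at least like \<open>2 ^ n\<close>, so the towers exhaust the half-line.\<close>

lemma height_ge_power: "2 ^ n * 3 ^ n \<le> height n"
  by (induction n) (simp_all add: height_Suc del: tower.simps(2))

declare tower.simps(2) [simp del]

lemma Union_grid_intervals:
  assumes "0 < (w::real)"
  shows "(\<Union>a\<in>(\<lambda>k. real k * w) ` {..<m}. {a..<a + w}) = {0..<real m * w}"
proof (induction m)
  case 0
  then show ?case by simp
next
  case (Suc m)
  have "0 \<le> real m * w" using assms by simp
  then have "{0..<real m * w} \<union> {real m * w..<real m * w + w} = {0..<real m * w + w}"
    using assms by (intro ivl_disj_un) auto
  with Suc show ?case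
    by (simp add: lessThan_Suc Un_commute algebra_simps)
qed

lemma lessThan_times_3: "{..<3 * m} = (\<lambda>k. 3 * k) ` {..<m} \<union> (\<lambda>k. 3 * k + 1) ` {..<m} \<union> (\<lambda>k. 3 * k + 2) ` {..<m::nat}"
proof (intro equalityI subsetI)
  fix j assume "j \<in> {..<3 * m}"
  then have "j div 3 < m" by auto
  moreover have "j = 3 * (j div 3) \<or> j = 3 * (j div 3) + 1 \<or> j = 3 * (j div 3) + 2" by presburger
  ultimately obtain k where "k < m" "j = 3 * k \<or> j = 3 * k + 1 \<or> j = 3 * k + 2" by blast
  then show "j \<in> (\<lambda>k. 3 * k) ` {..<m} \<union> (\<lambda>k. 3 * k + 1) ` {..<m} \<union> (\<lambda>k. 3 * k + 2) ` {..<m}"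
    by auto
qed auto

text \<open>The used part of the half-line is an initial segment, so the new intervals are consecutive and begin
  at its right end. The first of them, above the middle subcolumn, starts at
  \<open>height n / 3 ^ n\<close>, written here with denominator \<open>3 ^ Suc n\<close>.\<close>

lemma tower_Suc_explicit:
  assumes "set (tower n) = (\<lambda>k. real k / 3 ^ n) ` {..<height n}"
  shows "tower (Suc n) =
    tower n @ map (\<lambda>a. a + 1 / 3 ^ Suc n) (tower n) @ [real (3 * height n) / 3 ^ Suc n] @
    map (\<lambda>a. a + 2 / 3 ^ Suc n) (tower n) @
    map (\<lambda>j. real j / 3 ^ Suc n) [Suc (3 * height n)..<6 * height n + 2]"
proof -
  define h where "h = height n"
  define w :: real where "w = 1 / 3 ^ Suc n"
  have U: "(\<Union>a\<in>set (tower n). {a..<a + 1 / 3 ^ n}) = {0..<real (3 * h) * w}"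
    using Union_grid_intervals [of "1 / 3 ^ n" h] assms by (simp add: h_def w_def)
  have "pick_intervals (1 + (3 * h + 1)) w {0..<real (3 * h) * w}
      = map (\<lambda>j. real (3 * h) * w + real j * w) [0..<1 + (3 * h + 1)]"
    by (rule pick_intervals_initial) (auto simp: w_def)
  also have "\<dots> = map (\<lambda>j. real j * w) [3 * h..<6 * h + 2]"
    by (rule nth_equalityI) (auto simp: algebra_simps simp del: upt_Suc)
  also have "\<dots> = (real (3 * h) * w) # map (\<lambda>j. real j * w) [Suc (3 * h)..<6 * h + 2]"
    by (subst upt_conv_Cons) (simp_all del: upt_Suc)
  finally show ?thesis
    using U unfolding tower.simps(2) Let_def h_def w_def by simp
qed

lemma set_tower: "set (tower n) = (\<lambda>k. real k / 3 ^ n) ` {..<height n}"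
proof (induction n)
  case 0
  then show ?case by (simp add: lessThan_Suc)
next
  case (Suc n)
  let ?h = "height n" and ?q = "\<lambda>k. real k / 3 ^ Suc n"
  have split: "{..<6 * ?h + 2} = {..<3 * ?h} \<union> {3 * ?h} \<union> {Suc (3 * ?h)..<6 * ?h + 2}"
    by auto
  have "?q ` {..<3 * ?h} = set (tower n) \<union> (\<lambda>a. a + 1 / 3 ^ Suc n) ` set (tower n)
      \<union> (\<lambda>a. a + 2 / 3 ^ Suc n) ` set (tower n)"
    unfolding lessThan_times_3 Suc.IH image_Un image_image
    by (intro arg_cong2 [where f = "(\<union>)"] image_cong) (auto simp: field_simps)
  moreover have "?q ` {..<height (Suc n)} = ?q ` {..<3 * ?h} \<union> {?q (3 * ?h)} \<union> ?q ` {Suc (3 * ?h)..<6 * ?h + 2}"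
    unfolding height_Suc split image_Un by simp
  moreover have "set (tower (Suc n)) = (set (tower n) \<union> (\<lambda>a. a + 1 / 3 ^ Suc n) ` set (tower n)
      \<union> (\<lambda>a. a + 2 / 3 ^ Suc n) ` set (tower n)) \<union> {?q (3 * ?h)} \<union> ?q ` {Suc (3 * ?h)..<6 * ?h + 2}"
    unfolding tower_Suc_explicit [OF Suc.IH] set_append set_map list.set set_upt by (simp only: Un_ac)
  ultimately show ?case by simp
qed

text \<open>What the column chosen by a digit adds to the height of a point: nothing for the left one, the
  left column for the middle one, and both columns with the spacer between them for the right one.\<close>

definition shift :: "nat \<Rightarrow> int \<Rightarrow> nat" where
  "shift n d = (if d = 0 then 0 else if d = 1 then height n else 2 * height n + 1)"

lemma tower_Suc_nth:
  assumes "i < height n" "d \<in> {0, 1, 2}"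
  shows "tower (Suc n) ! (i + shift n d) = tower n ! i + real_of_int d / 3 ^ Suc n"
  using assms unfolding tower_Suc_explicit [OF set_tower]
  by (auto simp: shift_def nth_append)

lemma shift_less_height:
  "i < height n \<Longrightarrow> Suc (i + shift n d) < height (Suc n)"
  by (auto simp: shift_def height_Suc)

lemma distinct_tower: "distinct (tower n)"
  by (rule card_distinct) (simp add: set_tower card_image inj_on_def)

section \<open>Ternary digits and positions in the towers\<close>

definition digit :: "nat \<Rightarrow> real \<Rightarrow> int" where
  "digit n x = \<lfloor>3 ^ Suc n * x\<rfloor> mod 3"

lemma digit_cases: "digit n x \<in> {0, 1, 2}"
proof -
  have "0 \<le> digit n x" "digit n x < 3" by (auto simp: digit_def)
  then show ?thesis by auto
qed

lemma floor_Suc: "\<lfloor>3 ^ Suc n * x\<rfloor> = 3 * \<lfloor>3 ^ n * x\<rfloor> + digit n x"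
proof -
  have "\<lfloor>3 ^ n * x\<rfloor> = \<lfloor>3 ^ Suc n * x\<rfloor> div 3"
    using floor_divide_real_eq_div [of 3 "3 ^ Suc n * x"] by simp
  then show ?thesis by (simp add: digit_def)
qed

text \<open>Levels are triadic intervals, so the level of a point depends only on an integer part; this makes
  maps that change late ternary digits preserve the levels of the early towers.\<close>

lemma mem_level_iff:
  assumes "i < height n"
  shows "x \<in> level n i \<longleftrightarrow> real_of_int \<lfloor>3 ^ n * x\<rfloor> = 3 ^ n * tower n ! i"
proof -
  have "tower n ! i \<in> set (tower n)" using assms by simp
  then obtain k where k: "tower n ! i = real k / 3 ^ n" unfolding set_tower by auto
  have "x \<in> level n i \<longleftrightarrow> real k \<le> 3 ^ n * x \<and> 3 ^ n * x < real k + 1"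
    by (simp add: level_def k field_simps)
  also have "\<dots> \<longleftrightarrow> \<lfloor>3 ^ n * x\<rfloor> = int k" by (simp add: floor_eq_iff)
  also have "\<dots> \<longleftrightarrow> real_of_int \<lfloor>3 ^ n * x\<rfloor> = real k"
    by (metis of_int_eq_iff of_int_of_nat_eq)
  finally show ?thesis by (simp add: k)
qed

lemma level_Suc:
  assumes "i < height n" "x \<in> level n i"
  shows "x \<in> level (Suc n) (i + shift n (digit n x))"
proof -
  have "real_of_int \<lfloor>3 ^ Suc n * x\<rfloor> = 3 * (3 ^ n * tower n ! i) + digit n x"
    using assms mem_level_iff [OF assms(1)] unfolding floor_Suc by simp
  also have "\<dots> = 3 ^ Suc n * tower (Suc n) ! (i + shift n (digit n x))"
    unfolding tower_Suc_nth [OF assms(1) digit_cases] by (simp add: algebra_simps)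
  finally show ?thesis
    using shift_less_height [OF assms(1), THEN Suc_lessD] by (subst mem_level_iff) auto
qed

lemma level_unique:
  assumes "x \<in> level n i" "x \<in> level n j" "i < height n" "j < height n"
  shows "i = j"
proof -
  have "(3::real) ^ n * tower n ! i = 3 ^ n * tower n ! j"
    using assms by (metis mem_level_iff)
  then show ?thesis
    using assms distinct_tower by (simp add: nth_eq_iff_index_eq)
qed

definition tower_space :: "nat \<Rightarrow> real set" where
  "tower_space n = {0..<real (height n) / 3 ^ n}"

lemma tower_space_eq_Union_levels: "tower_space n = (\<Union>i<height n. level n i)"
proof -
  have "tower_space n = (\<Union>a\<in>(\<lambda>k. real k / 3 ^ n) ` {..<height n}. {a..<a + 1 / 3 ^ n})"
    using Union_grid_intervals [of "1 / 3 ^ n" "height n"] by (simp add: tower_space_def)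
  also have "\<dots> = (\<Union>a\<in>set (tower n). {a..<a + 1 / 3 ^ n})"
    by (simp only: set_tower)
  also have "\<dots> = (\<Union>i<height n. level n i)"
    by (force simp: set_conv_nth level_def)
  finally show ?thesis .
qed

lemma tower_space_Suc: "tower_space n \<subseteq> tower_space (Suc n)"
proof
  fix x assume "x \<in> tower_space n"
  then obtain i where i: "i < height n" "x \<in> level n i"
    unfolding tower_space_eq_Union_levels by blast
  then show "x \<in> tower_space (Suc n)"
    using level_Suc [OF i] shift_less_height [OF i(1), THEN Suc_lessD]
    unfolding tower_space_eq_Union_levels by blast
qed

lemma tower_space_mono: "m \<le> n \<Longrightarrow> tower_space m \<subseteq> tower_space n"
  by (rule lift_Suc_mono_le [of tower_space]) (auto simp: tower_space_Suc)

lemma eventually_in_tower_space: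
  assumes "0 \<le> x"
  shows "\<exists>n. x \<in> tower_space n"
proof -
  obtain n where n: "x < 2 ^ n"
    using real_arch_pow [of 2 x] by auto
  have "(2::real) ^ n * 3 ^ n \<le> real (height n)"
    using of_nat_mono [OF height_ge_power [of n], where 'a = real] by simp
  then have "2 ^ n \<le> real (height n) / 3 ^ n"
    by (simp add: field_simps)
  with n assms show ?thesis
    by (intro exI [of _ n]) (simp add: tower_space_def)
qed

definition position :: "nat \<Rightarrow> real \<Rightarrow> nat" where
  "position n x = (THE i. i < height n \<and> x \<in> level n i)"

lemma position_eqI: "i < height n \<Longrightarrow> x \<in> level n i \<Longrightarrow> position n x = i"
  unfolding position_def using level_unique by (intro the_equality) auto

lemma
  assumes "x \<in> tower_space n"
  shows position_less: "position n x < height n"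
    and in_level_position: "x \<in> level n (position n x)"
  using assms position_eqI unfolding tower_space_eq_Union_levels by auto

lemma level_imp_tower_space: "i < height n \<Longrightarrow> x \<in> level n i \<Longrightarrow> x \<in> tower_space n"
  unfolding tower_space_eq_Union_levels by blast

lemma position_Suc:
  assumes "x \<in> tower_space n"
  shows "position (Suc n) x = position n x + shift n (digit n x)"
  using level_Suc [OF position_less in_level_position] shift_less_height [OF position_less] assms
  by (intro position_eqI) (auto simp: Suc_lessD)

lemma eq_tower_plus_frac:
  assumes "x \<in> tower_space n"
  shows "x = tower n ! position n x + frac (3 ^ n * x) / 3 ^ n"
  using mem_level_iff [OF position_less] in_level_position assms
  by (simp add: frac_def field_simps)

text \<open>Position and offset are coordinates on a tower in which the transformation moves the position
  by one and fixes the offset.\<close>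

lemma position_frac_inject:
  assumes "x \<in> tower_space n" "y \<in> tower_space n"
    "position n x = position n y" "frac (3 ^ n * x) = frac (3 ^ n * y)"
  shows "x = y"
  using assms eq_tower_plus_frac by metis

lemma position_and_frac_eqI:
  assumes "i < height n" "0 \<le> t" "t < 1" "x = tower n ! i + t / 3 ^ n"
  shows "x \<in> tower_space n" "position n x = i" "frac (3 ^ n * x) = t"
proof -
  have "x \<in> level n i"
    using assms by (simp add: level_def divide_strict_right_mono)
  then show "x \<in> tower_space n" "position n x = i"
    using assms by (auto intro: level_imp_tower_space position_eqI)
  then show "frac (3 ^ n * x) = t"
    using eq_tower_plus_frac [of x n] assms by simp
qed

section \<open>The transformation in tower coordinates\<close>

text \<open>A level and the one above it are cut at the same points, so the next tower prescribes the same
  translation. This is why the definite description in the definition of the transformation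
  does not depend on the tower in which it is read.\<close>

lemma chacon_wd_Suc:
  assumes "Suc i < height n" "x \<in> level n i"
  shows "\<exists>j. Suc j < height (Suc n) \<and> x \<in> level (Suc n) j \<and>
    tower (Suc n) ! Suc j + (x - tower (Suc n) ! j) = tower n ! Suc i + (x - tower n ! i)"
proof (intro exI conjI)
  let ?j = "i + shift n (digit n x)"
  show "Suc ?j < height (Suc n)" using assms by (intro shift_less_height) auto
  show "x \<in> level (Suc n) ?j" using assms by (intro level_Suc) auto
  show "tower (Suc n) ! Suc ?j + (x - tower (Suc n) ! ?j) = tower n ! Suc i + (x - tower n ! i)"
    using tower_Suc_nth [OF assms(1) digit_cases [of n x]] 
      tower_Suc_nth [OF Suc_lessD [OF assms(1)] digit_cases [of n x]] by simp
qed

lemma chacon_wd_add: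
  assumes "Suc i < height n" "x \<in> level n i"
  shows "\<exists>j. Suc j < height (n + k) \<and> x \<in> level (n + k) j \<and>
    tower (n + k) ! Suc j + (x - tower (n + k) ! j) = tower n ! Suc i + (x - tower n ! i)"
proof (induction k)
  case 0
  then show ?case using assms by auto
next
  case (Suc k)
  then show ?case by (metis chacon_wd_Suc add_Suc_right)
qed

lemma chacon_eq:
  assumes "Suc i < height n" "x \<in> level n i"
  shows "chacon x = tower n ! Suc i + (x - tower n ! i)"
  unfolding chacon_def
proof (rule the_equality)
  show "\<exists>n' i'. Suc i' < height n' \<and> x \<in> level n' i' \<and>
      tower n ! Suc i + (x - tower n ! i) = tower n' ! Suc i' + (x - tower n' ! i')"
    using assms by blast
next
  fix y assume "\<exists>n i. Suc i < height n \<and> x \<in> level n i \<and> y = tower n ! Suc i + (x - tower n ! i)"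
  then obtain m j where m: "Suc j < height m" "x \<in> level m j" 
    and y: "y = tower m ! Suc j + (x - tower m ! j)" by blast
  obtain i' where i': "Suc i' < height (n + m)" "x \<in> level (n + m) i'"
    "tower (n + m) ! Suc i' + (x - tower (n + m) ! i') = tower n ! Suc i + (x - tower n ! i)"
    using chacon_wd_add [OF assms] by blast
  obtain j' where j': "Suc j' < height (n + m)" "x \<in> level (n + m) j'"
    "tower (n + m) ! Suc j' + (x - tower (n + m) ! j') = y"
    using chacon_wd_add [OF m, of n] unfolding y add.commute [of m n] by blast
  have "i' = j'" using i' j' by (intro level_unique) auto
  with i' j' show "y = tower n ! Suc i + (x - tower n ! i)" by simp
qed

lemma chacon_in_tower:
  assumes "x \<in> tower_space n" "Suc (position n x) < height n"
  shows "chacon x \<in> tower_space n" "position n (chacon x) = Suc (position n x)"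
    "frac (3 ^ n * chacon x) = frac (3 ^ n * x)"
proof -
  have "chacon x = tower n ! Suc (position n x) + frac (3 ^ n * x) / 3 ^ n"
    using chacon_eq [OF assms(2) in_level_position] eq_tower_plus_frac [OF assms(1)] assms(1)
    by simp
  from position_and_frac_eqI [OF assms(2) _ _ this]
  show "chacon x \<in> tower_space n" "position n (chacon x) = Suc (position n x)"
    "frac (3 ^ n * chacon x) = frac (3 ^ n * x)"
    by (auto simp: frac_lt_1)
qed

text \<open>The top of each tower is a spacer of that step, so a point that is already in the previous tower is
  not in the top level.\<close>

lemma eventually_below_top:
  assumes "0 \<le> x"
  shows "\<exists>n0. \<forall>n\<ge>n0. x \<in> tower_space n \<and> Suc (position n x) < height n"
proof -
  obtain m where m: "x \<in> tower_space m" using eventually_in_tower_space [OF assms] by blast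
  have "x \<in> tower_space n \<and> Suc (position n x) < height n" if "n \<ge> Suc m" for n
  proof -
    obtain n' where n': "n = Suc n'" "n' \<ge> m" using \<open>n \<ge> Suc m\<close> by (cases n) auto
    then have "x \<in> tower_space n'" using m tower_space_mono by blast
    then show ?thesis
      using n' tower_space_Suc [of n'] shift_less_height [OF position_less] position_Suc [of x n'] by auto
  qed
  then show ?thesis by blast
qed

lemma chacon_nonneg:
  assumes "0 \<le> x"
  shows "0 \<le> chacon x"
proof -
  obtain n where "x \<in> tower_space n" "Suc (position n x) < height n"
    using eventually_below_top [OF assms] by blast
  then have "chacon x \<in> tower_space n" by (rule chacon_in_tower)
  then show ?thesis by (simp add: tower_space_def)
qed

lemma chacon_funpow_nonneg: "0 \<le> x \<Longrightarrow> 0 \<le> (chacon ^^ k) x"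
  by (induction k) (auto simp: chacon_nonneg)

lemma inj_on_chacon: "inj_on chacon {0..}"
proof (rule inj_onI)
  fix x y assume "x \<in> {0..}" "y \<in> {0..}" and eq: "chacon x = chacon y"
  then obtain m m' where "\<forall>n\<ge>m. x \<in> tower_space n \<and> Suc (position n x) < height n"
    "\<forall>n\<ge>m'. y \<in> tower_space n \<and> Suc (position n y) < height n"
    using eventually_below_top by (metis atLeast_iff)
  then have "x \<in> tower_space (max m m')" "Suc (position (max m m') x) < height (max m m')"
    "y \<in> tower_space (max m m')" "Suc (position (max m m') y) < height (max m m')"
    by auto
  then show "x = y"
    using chacon_in_tower eq by (metis Suc_inject position_frac_inject)
qed

lemma chacon_funpow_inject:
  "0 \<le> x \<Longrightarrow> 0 \<le> y \<Longrightarrow> (chacon ^^ k) x = (chacon ^^ k) y \<longleftrightarrow> x = y"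
proof (induction k)
  case (Suc k)
  then show ?case
    using inj_on_chacon chacon_funpow_nonneg by (auto simp: inj_on_eq_iff)
qed simp

lemma chacon_funpow_eqI:
  assumes "x \<in> tower_space n" "y \<in> tower_space n"
    "frac (3 ^ n * x) = frac (3 ^ n * y)" "position n y = position n x + k"
  shows "y = (chacon ^^ k) x"
proof -
  have top: "position n x + k < height n"
    using position_less [OF assms(2)] assms(4) by simp
  have "(chacon ^^ j) x \<in> tower_space n \<and> position n ((chacon ^^ j) x) = position n x + j
      \<and> frac (3 ^ n * (chacon ^^ j) x) = frac (3 ^ n * x)" if "j \<le> k" for j
    using that
  proof (induction j)
    case 0
    show ?case using assms(1) by simp
  next
    case (Suc j)
    let ?z = "(chacon ^^ j) x"
    have z: "?z \<in> tower_space n" "position n ?z = position n x + j" 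
        "frac (3 ^ n * ?z) = frac (3 ^ n * x)"
      using Suc.IH Suc_leD [OF Suc.prems] by auto
    then have "Suc (position n ?z) < height n"
      using top Suc.prems by linarith
    from chacon_in_tower [OF z(1) this] z(2,3) show ?case by simp
  qed
  from this [of k] show ?thesis
    using assms by (intro position_frac_inject [of y n]) simp_all
qed

lemma eventually_position_chacon_funpow:
  assumes "0 \<le> x"
  shows "\<exists>n0. \<forall>n\<ge>n0. position n ((chacon ^^ k) x) = position n x + k"
proof (induction k)
  case (Suc k)
  then obtain n1 where n1: "\<forall>n\<ge>n1. position n ((chacon ^^ k) x) = position n x + k" by blast
  obtain n2 where "\<forall>n\<ge>n2. (chacon ^^ k) x \<in> tower_space n \<and> Suc (position n ((chacon ^^ k) x)) < height n"
    using eventually_below_top [OF chacon_funpow_nonneg [OF assms]] by blast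
  then have "position n ((chacon ^^ Suc k) x) = position n x + Suc k" if "n \<ge> max n1 n2" for n
    using chacon_in_tower(2) [of "(chacon ^^ k) x" n] n1 that by (metis add_Suc_right funpow.simps(2) max.bounded_iff o_apply)
  then show ?case by blast
qed simp

section \<open>Digit expansions of return times\<close>

lemma position_add:
  assumes "x \<in> tower_space n"
  shows "position (n + m) x = position n x + (\<Sum>i=n..<n + m. shift i (digit i x))"
proof (induction m)
  case (Suc m)
  have "x \<in> tower_space (n + m)"
    using assms tower_space_mono [of n "n + m"] by auto
  then show ?case using Suc by (simp add: position_Suc)
qed simp

lemma digit_cong:
  assumes "frac (3 ^ n * x) = frac (3 ^ n * y)" "n \<le> i"
  shows "digit i x = digit i y"
proof -
  let ?k = "\<lfloor>3 ^ n * x\<rfloor> - \<lfloor>3 ^ n * y\<rfloor>"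
  have "3 ^ n * x = 3 ^ n * y + real_of_int ?k"
    using assms(1) by (simp add: frac_def)
  then have "3 ^ (i - n) * 3 * (3 ^ n * x) = 3 ^ (i - n) * 3 * (3 ^ n * y + real_of_int ?k)" by simp
  then have "3 ^ Suc i * x = 3 ^ Suc i * y + real_of_int (3 * (3 ^ (i - n) * ?k))"
    using power_add [of "3::real" n "i - n"] assms(2) by (simp add: algebra_simps)
  then have "\<lfloor>3 ^ Suc i * x\<rfloor> = \<lfloor>3 ^ Suc i * y\<rfloor> + 3 * (3 ^ (i - n) * ?k)"
    by (metis floor_add_int)
  then show ?thesis by (simp add: digit_def)
qed

text \<open>The integer parts of \<open>3 ^ (n + m) * x\<close> and \<open>3 ^ (n + m) * y\<close> then differ by \<open>3 ^ m\<close> times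
  what they differ by for \<open>m = 0\<close>, so the fractional parts of \<open>3 ^ n * x\<close> and \<open>3 ^ n * y\<close> are within
  \<open>1 / 3 ^ m\<close> of each other for all \<open>m\<close>.\<close>

lemma frac_eqI_digits:
  assumes "\<And>i. n \<le> i \<Longrightarrow> digit i x = digit i y"
  shows "frac (3 ^ n * x) = frac (3 ^ n * y)"
proof -
  let ?f = "\<lambda>m. \<lfloor>3 ^ m * x\<rfloor> - \<lfloor>3 ^ m * y\<rfloor>"
  have f: "?f (n + m) = 3 ^ m * ?f n" for m
  proof (induction m)
    case (Suc m)
    then show ?case
      using floor_Suc [of "n + m" x] floor_Suc [of "n + m" y] assms [of "n + m"] by simp
  qed simp
  have "\<bar>3 ^ n * x - 3 ^ n * y - real_of_int (?f n)\<bar> \<le> (1 / 3) ^ m" for m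
  proof -
    have "\<bar>3 ^ (n + m) * x - 3 ^ (n + m) * y - real_of_int (?f (n + m))\<bar> \<le> 1"
      by linarith
    then have "\<bar>3 ^ m * (3 ^ n * x - 3 ^ n * y - real_of_int (?f n))\<bar> \<le> 1"
      unfolding f by (simp add: power_add algebra_simps)
    then have "3 ^ m * \<bar>3 ^ n * x - 3 ^ n * y - real_of_int (?f n)\<bar> \<le> 1"
      by (simp add: abs_mult)
    then show ?thesis
      by (simp add: power_divide pos_le_divide_eq mult.commute)
  qed
  moreover have "(\<lambda>m. (1 / 3 :: real) ^ m) \<longlonglongrightarrow> 0"
    by (rule LIMSEQ_realpow_zero) auto
  ultimately have "\<bar>3 ^ n * x - 3 ^ n * y - real_of_int (?f n)\<bar> \<le> 0"
    by (intro Lim_bounded2 [where N = 0]) auto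
  then show ?thesis by (simp add: frac_def)
qed

definition shift_diff :: "nat \<Rightarrow> int \<Rightarrow> int \<Rightarrow> int" where
  "shift_diff i d d' = int (shift i d') - int (shift i d)"

lemma shift_diff_commute: "shift_diff i d' d = - shift_diff i d d'"
  by (simp add: shift_diff_def)

lemma sum_max_shift_less: "(\<Sum>i<m. 4 * int (height i) + 2) < int (height m)"
  by (induction m) (auto simp: height_Suc)

text \<open>The heights grow so fast that the last nonzero term of such a sum exceeds all the earlier ones
  together. The bound \<open>4 h + 2\<close> is twice the largest difference of two shifts, because the terms will
  be differences of two such differences.\<close>

lemma sparse_sum_eq_0:
  assumes "(\<Sum>i<m. u i) = 0"
    and "\<And>i. i < m \<Longrightarrow> u i = 0 \<or> int (height i) \<le> \<bar>u i\<bar>"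
    and "\<And>i. i < m \<Longrightarrow> \<bar>u i\<bar> \<le> 4 * int (height i) + 2"
    and "i < m"
  shows "u i = 0"
  using assms
proof (induction m arbitrary: i)
  case (Suc m)
  have "\<bar>\<Sum>i<m. u i\<bar> \<le> (\<Sum>i<m. 4 * int (height i) + 2)"
    using Suc.prems(3) by (intro order_trans [OF sum_abs] sum_mono) auto
  then have "\<bar>\<Sum>i<m. u i\<bar> < int (height m)"
    using sum_max_shift_less [of m] by linarith
  moreover have "\<bar>\<Sum>i<m. u i\<bar> = \<bar>u m\<bar>"
    using Suc.prems(1) by simp
  ultimately have "u m = 0"
    using Suc.prems(2) [of m] by force
  moreover have "u i = 0" if "i < m"
    using Suc.prems \<open>u m = 0\<close> that by (intro Suc.IH) auto
  ultimately show ?case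
    using Suc.prems(4) less_Suc_eq by auto
qed simp

lemma abs_shift_diff_le: "\<bar>shift_diff i d d'\<bar> \<le> 2 * int (height i) + 1"
  by (simp add: shift_diff_def shift_def)

text \<open>In a tower that is high enough, the return time \<open>k\<close> is the difference of the positions both of
  \<open>y, y'\<close> and of \<open>z, z'\<close>. Expanding both in digits gives two sums of differences of shifts, which agree
  place by place if no place confuses values that are close but distinct.\<close>

lemma equal_shift_diffs_forward:
  assumes y: "y \<in> tower_space n" "y' \<in> tower_space n" "position n y = position n y'"
    and z: "z \<in> {0..<1}" "z' \<in> {0..<1}"
    and k: "y' = (chacon ^^ k) y" "z' = (chacon ^^ k) z"
    and sep: "\<And>i. n \<le> i \<Longrightarrow>
        shift_diff i (digit i y) (digit i y') = shift_diff i (digit i z) (digit i z') \<or>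
        int (height i) \<le> \<bar>shift_diff i (digit i y) (digit i y') - shift_diff i (digit i z) (digit i z')\<bar>"
    and i: "n \<le> i"
  shows "shift_diff i (digit i y) (digit i y') = shift_diff i (digit i z) (digit i z')"
proof -
  have pos: "0 \<le> y" "0 \<le> z" using y z by (auto simp: tower_space_def)
  obtain m1 where m1: "\<forall>m\<ge>m1. position m y' = position m y + k"
    using eventually_position_chacon_funpow [OF pos(1)] k(1) by blast
  obtain m2 where m2: "\<forall>m\<ge>m2. position m z' = position m z + k"
    using eventually_position_chacon_funpow [OF pos(2)] k(2) by blast
  define m where "m = max (max m1 m2) (Suc i)"
  have m: "n \<le> m" "i < m" "position m y' = position m y + k" "position m z' = position m z + k"
    using m1 m2 i by (auto simp: m_def)
  define \<delta> where "\<delta> j = (if j < n then 0 else shift_diff j (digit j y) (digit j y'))" for j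
  define \<delta>' where "\<delta>' j = shift_diff j (digit j z) (digit j z')" for j
  have "{..<m} = {..<n} \<union> {n..<m}" using m by auto
  then have "(\<Sum>j<m. \<delta> j) = (\<Sum>j<n. \<delta> j) + (\<Sum>j=n..<m. \<delta> j)"
    by (simp add: sum.union_disjoint ivl_disj_int)
  also have "\<dots> = (\<Sum>j=n..<m. shift_diff j (digit j y) (digit j y'))"
    by (simp add: \<delta>_def)
  also have "\<dots> = int (position m y') - int (position m y)"
    using position_add [OF y(1), of "m - n"] position_add [OF y(2), of "m - n"] m(1) y(3)
    by (simp add: shift_diff_def sum_subtractf)
  also have "\<dots> = int (position m z') - int (position m z)"
    using m by simp
  also have "\<dots> = (\<Sum>j<m. \<delta>' j)"
  proof -
    have z0: "z \<in> tower_space 0" "z' \<in> tower_space 0"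
      using z by (auto simp: tower_space_def)
    then have "position 0 z = 0" "position 0 z' = 0"
      using position_less by force+
    then show ?thesis
      using position_add [OF z0(1), of m] position_add [OF z0(2), of m]
      by (simp add: \<delta>'_def shift_diff_def sum_subtractf lessThan_atLeast0)
  qed
  finally have sum: "(\<Sum>j<m. \<delta> j - \<delta>' j) = 0"
    by (simp add: sum_subtractf)
  have "\<delta> i - \<delta>' i = 0"
  proof (rule sparse_sum_eq_0 [OF sum _ _ m(2)])
    fix j
    show "\<bar>\<delta> j - \<delta>' j\<bar> \<le> 4 * int (height j) + 2"
      using abs_shift_diff_le [of j "digit j y" "digit j y'"] 
        abs_shift_diff_le [of j "digit j z" "digit j z'"]
      by (auto simp: \<delta>_def \<delta>'_def)
    have "\<delta>' j = 0 \<or> int (height j) \<le> \<bar>\<delta>' j\<bar>"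
      using height_pos [of j] by (auto simp: \<delta>'_def shift_diff_def shift_def)
    then show "\<delta> j - \<delta>' j = 0 \<or> int (height j) \<le> \<bar>\<delta> j - \<delta>' j\<bar>"
      using sep [of j] by (auto simp: \<delta>_def \<delta>'_def)
  qed
  then show ?thesis using i by (simp add: \<delta>_def \<delta>'_def)
qed

text \<open>As the transformation is not onto, a negative power is expressed by exchanging the roles of the
  two points.\<close>

definition same_translate :: "real \<Rightarrow> real \<Rightarrow> real \<Rightarrow> real \<Rightarrow> bool" where
  "same_translate y y' z z' \<longleftrightarrow>
    (\<exists>k. y' = (chacon ^^ k) y \<and> z' = (chacon ^^ k) z \<or> y = (chacon ^^ k) y' \<and> z = (chacon ^^ k) z')"

lemma equal_shift_diffs:
  assumes y: "y \<in> tower_space n" "y' \<in> tower_space n" "position n y = position n y'"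
    and z: "z \<in> {0..<1}" "z' \<in> {0..<1}"
    and k: "same_translate y y' z z'"
    and sep: "\<And>i. n \<le> i \<Longrightarrow>
        shift_diff i (digit i y) (digit i y') = shift_diff i (digit i z) (digit i z') \<or>
        int (height i) \<le> \<bar>shift_diff i (digit i y) (digit i y') - shift_diff i (digit i z) (digit i z')\<bar>"
    and i: "n \<le> i"
  shows "shift_diff i (digit i y) (digit i y') = shift_diff i (digit i z) (digit i z')"
proof -
  from k consider k where "y' = (chacon ^^ k) y" "z' = (chacon ^^ k) z"
    | k where "y = (chacon ^^ k) y'" "z = (chacon ^^ k) z'"
    unfolding same_translate_def by blast
  then show ?thesis
  proof cases
    case 1
    show ?thesis by (rule equal_shift_diffs_forward [OF y z 1 sep i])
  next
    case 2
    have "shift_diff i (digit i y') (digit i y) = shift_diff i (digit i z') (digit i z)"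
    proof (rule equal_shift_diffs_forward [OF y(2,1) y(3) [symmetric] z(2,1) 2 _ i])
      fix j assume "n \<le> j"
      from sep [OF this] show "shift_diff j (digit j y') (digit j y) = shift_diff j (digit j z') (digit j z) \<or>
        int (height j) \<le> \<bar>shift_diff j (digit j y') (digit j y) - shift_diff j (digit j z') (digit j z)\<bar>"
        unfolding shift_diff_commute [of j "digit j y'"] shift_diff_commute [of j "digit j z'"]
        by linarith
    qed
    then show ?thesis
      unfolding shift_diff_commute [of i "digit i y'"] shift_diff_commute [of i "digit i z'"] by simp
  qed
qed

text \<open>The differences \<open>0\<close> and \<open>2 h + 1\<close> are at distance at least \<open>h\<close> from every other difference of shifts,
  and \<open>2 h + 1\<close> arises from the digits \<open>0\<close> and \<open>2\<close> only.\<close>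

lemma swap_02_transfers_digit:
  assumes y: "y \<in> tower_space n" "y' \<in> tower_space n" "position n y = position n y'"
    and z: "z \<in> {0..<1}" "z' \<in> {0..<1}"
    and k: "same_translate y y' z z'"
    and swap: "\<And>j. n \<le> j \<Longrightarrow> digit j y' = digit j y \<or> digit j y' = Transposition.transpose 0 2 (digit j y)"
    and i: "n \<le> i" "digit i y \<noteq> 1" "digit i y' = Transposition.transpose 0 2 (digit i y)"
  shows "digit i z = digit i y"
proof -
  have "shift_diff i (digit i y) (digit i y') = shift_diff i (digit i z) (digit i z')"
  proof (rule equal_shift_diffs [OF y z k _ i(1)])
    fix j assume "n \<le> j"
    from swap [OF this] show "shift_diff j (digit j y) (digit j y') = shift_diff j (digit j z) (digit j z') \<or>
        int (height j) \<le> \<bar>shift_diff j (digit j y) (digit j y') - shift_diff j (digit j z) (digit j z')\<bar>"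
      using digit_cases [of j y] digit_cases [of j z] digit_cases [of j z'] height_pos [of j]
      by (auto simp: shift_diff_def shift_def Transposition.transpose_def)
  qed
  then show ?thesis
    using i(2,3) digit_cases [of i y] digit_cases [of i z] digit_cases [of i z'] height_pos [of i]
    by (auto simp: shift_diff_def shift_def Transposition.transpose_def)
qed

text \<open>The difference \<open>h\<close>, coming from the digits \<open>0\<close> and \<open>1\<close>, is close to \<open>h + 1\<close>, coming from the digits
  \<open>1\<close> and \<open>2\<close>. The hypothesis \<open>agree\<close> forces the image of the point with digit \<open>0\<close> to have digit \<open>0\<close>
  as well, and a difference between the digit \<open>0\<close> and another one is never \<open>h + 1\<close>.\<close>

lemma swap_01_transfers_digit:
  assumes y: "y \<in> tower_space n" "y' \<in> tower_space n" "position n y = position n y'"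
    and z: "z \<in> {0..<1}" "z' \<in> {0..<1}"
    and k: "same_translate y y' z z'"
    and swap: "\<And>j. n \<le> j \<Longrightarrow> digit j y' = digit j y \<or> digit j y' = Transposition.transpose 0 1 (digit j y)"
    and agree: "\<And>j. n \<le> j \<Longrightarrow> digit j y \<noteq> 1 \<Longrightarrow> digit j z = digit j y"
      "\<And>j. n \<le> j \<Longrightarrow> digit j y' \<noteq> 1 \<Longrightarrow> digit j z' = digit j y'"
    and i: "n \<le> i" "digit i y' = Transposition.transpose 0 1 (digit i y)"
  shows "digit i z = digit i y"
proof -
  have "shift_diff i (digit i y) (digit i y') = shift_diff i (digit i z) (digit i z')"
  proof (rule equal_shift_diffs [OF y z k _ i(1)])
    fix j assume "n \<le> j"
    from swap [OF this] agree [OF this]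
    show "shift_diff j (digit j y) (digit j y') = shift_diff j (digit j z) (digit j z') \<or>
        int (height j) \<le> \<bar>shift_diff j (digit j y) (digit j y') - shift_diff j (digit j z) (digit j z')\<bar>"
      using digit_cases [of j y] digit_cases [of j z] digit_cases [of j z'] height_pos [of j]
      by (auto simp: shift_diff_def shift_def Transposition.transpose_def)
  qed
  then show ?thesis
    using i agree [of i] digit_cases [of i y] digit_cases [of i z] digit_cases [of i z'] height_pos [of i]
    by (auto simp: shift_diff_def shift_def Transposition.transpose_def)
qed

section \<open>Exchanging two digits preserves Lebesgue measure\<close>

lemma floor_eq_mono:
  fixes x y :: real
  assumes "\<lfloor>3 ^ n * x\<rfloor> = \<lfloor>3 ^ n * y\<rfloor>" "m \<le> n"
  shows "\<lfloor>3 ^ m * x\<rfloor> = \<lfloor>3 ^ m * y\<rfloor>"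
  using assms
proof (induction n)
  case (Suc n)
  have "\<lfloor>3 ^ n * x\<rfloor> = \<lfloor>3 ^ n * y\<rfloor>"
    using Suc.prems(1) floor_Suc [of n x] floor_Suc [of n y] digit_cases [of n x] digit_cases [of n y]
    by auto
  with Suc show ?case by (auto simp: le_Suc_eq simp del: power_Suc)
qed simp

definition swap_digit :: "int \<Rightarrow> int \<Rightarrow> nat \<Rightarrow> real \<Rightarrow> real" where
  "swap_digit a b i x =
     x + real_of_int (Transposition.transpose a b (digit i x) - digit i x) / 3 ^ Suc i"

lemma floor_add_div_power: "\<lfloor>3 ^ Suc i * (x + real_of_int k / 3 ^ Suc i)\<rfloor> = \<lfloor>3 ^ Suc i * x\<rfloor> + k"
proof -
  have "3 ^ Suc i * (x + real_of_int k / 3 ^ Suc i) = 3 ^ Suc i * x + real_of_int k"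
    by (simp add: field_simps)
  then show ?thesis by (simp only: floor_add_int [symmetric])
qed

lemma digit_add_div_power: "digit i (x + real_of_int k / 3 ^ Suc i) = (digit i x + k) mod 3"
  unfolding digit_def floor_add_div_power by (simp add: mod_simps)

lemma frac_add_div_power:
  assumes "i < j"
  shows "frac (3 ^ j * (x + real_of_int k / 3 ^ Suc i)) = frac (3 ^ j * x)"
proof -
  have "(3::real) ^ j = 3 ^ Suc i * 3 ^ (j - Suc i)"
    using assms power_add [of "3::real" "Suc i" "j - Suc i"] by simp
  then have "3 ^ j * (x + real_of_int k / 3 ^ Suc i) = 3 ^ j * x + real_of_int (k * 3 ^ (j - Suc i))"
    by (simp add: field_simps)
  then show ?thesis
    unfolding frac_def by (simp only: floor_add_int [symmetric])
qed

lemma borel_measurable_digit [measurable]: "digit i \<in> measurable borel (count_space UNIV)"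
  unfolding digit_def by measurable

lemma sets_translate: "B \<in> sets borel \<Longrightarrow> (\<lambda>x. x + c) -` B \<in> sets (borel :: real measure)"
  by (rule measurable_sets_borel [of _ borel]) auto

lemma emeasure_lborel_translate:
  assumes "B \<in> sets borel"
  shows "emeasure lborel ((\<lambda>x. x + c) -` B) = emeasure lborel (B :: real set)"
proof -
  have "emeasure lborel B = emeasure (distr lborel borel ((+) c)) B"
    by (simp add: lborel_distr_plus)
  also have "\<dots> = emeasure lborel ((+) c -` B)"
    using assms by (subst emeasure_distr) auto
  finally show ?thesis by (simp add: add.commute [of c] vimage_def)
qed

context
  fixes a b :: int
  assumes ab: "a \<in> {0, 1, 2}" "b \<in> {0, 1, 2}"
begin

lemma transpose_digit_cases: "Transposition.transpose a b (digit i x) \<in> {0, 1, 2}"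
  using ab digit_cases [of i x] by (auto simp: Transposition.transpose_def)

lemma digit_swap_digit_same: "digit i (swap_digit a b i x) = Transposition.transpose a b (digit i x)"
  unfolding swap_digit_def digit_add_div_power using transpose_digit_cases [of i x] by auto

lemma floor_swap_digit:
  assumes "j \<le> i"
  shows "\<lfloor>3 ^ j * swap_digit a b i x\<rfloor> = \<lfloor>3 ^ j * x\<rfloor>"
proof (rule floor_eq_mono [OF _ assms])
  have "\<lfloor>3 ^ Suc i * swap_digit a b i x\<rfloor>
      = \<lfloor>3 ^ Suc i * x\<rfloor> + (Transposition.transpose a b (digit i x) - digit i x)"
    unfolding swap_digit_def by (rule floor_add_div_power)
  then show "\<lfloor>3 ^ i * swap_digit a b i x\<rfloor> = \<lfloor>3 ^ i * x\<rfloor>"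
    unfolding floor_Suc digit_swap_digit_same by simp
qed

lemma frac_swap_digit: "i < j \<Longrightarrow> frac (3 ^ j * swap_digit a b i x) = frac (3 ^ j * x)"
  unfolding swap_digit_def by (rule frac_add_div_power)

lemma digit_swap_digit_other:
  assumes "j \<noteq> i"
  shows "digit j (swap_digit a b i x) = digit j x"
proof (cases "j < i")
  case True
  then show ?thesis using floor_swap_digit [of "Suc j" i x] by (simp add: digit_def)
next
  case False
  then show ?thesis
    using assms by (intro digit_cong [of "Suc i"] frac_swap_digit) auto
qed

lemma borel_measurable_swap_digit [measurable]: "swap_digit a b i \<in> borel_measurable borel"
proof -
  have "(\<lambda>d. real_of_int (Transposition.transpose a b d - d) / 3 ^ Suc i)
      \<in> measurable (count_space UNIV) borel" by simp
  from measurable_compose [OF borel_measurable_digit this] show ?thesis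
    unfolding swap_digit_def [abs_def] by measurable
qed

text \<open>On the set where the digit has a given value the map is a translation onto the set where it has
  the exchanged value.\<close>

lemma emeasure_swap_digit_le:
  assumes B: "B \<in> sets borel"
  shows "emeasure lborel (swap_digit a b i -` B) \<le> emeasure lborel B"
proof -
  let ?\<tau> = "Transposition.transpose a b"
  let ?B = "\<lambda>d. B \<inter> digit i -` {d}"
  let ?c = "\<lambda>d. real_of_int (?\<tau> d - d) / 3 ^ Suc i"
  have meas: "?B d \<in> sets borel" for d
    using B measurable_sets [OF borel_measurable_digit, of "{d}" i] by auto
  have meas': "(\<lambda>x. x + ?c d) -` ?B (?\<tau> d) \<in> sets lborel" for d
    using sets_translate [OF meas] by simp
  have "swap_digit a b i -` B \<subseteq> (\<Union>d\<in>{0, 1, 2}. (\<lambda>x. x + ?c d) -` ?B (?\<tau> d))"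
  proof
    fix x assume x: "x \<in> swap_digit a b i -` B"
    then have "x \<in> (\<lambda>x. x + ?c (digit i x)) -` ?B (?\<tau> (digit i x))"
      using digit_swap_digit_same [of i x] by (simp add: swap_digit_def)
    with digit_cases show "x \<in> (\<Union>d\<in>{0, 1, 2}. (\<lambda>x. x + ?c d) -` ?B (?\<tau> d))" by blast
  qed
  then have "emeasure lborel (swap_digit a b i -` B)
      \<le> emeasure lborel (\<Union>d\<in>{0, 1, 2}. (\<lambda>x. x + ?c d) -` ?B (?\<tau> d))"
    by (intro emeasure_mono sets.finite_UN meas') auto
  also have "\<dots> \<le> (\<Sum>d\<in>{0, 1, 2}. emeasure lborel ((\<lambda>x. x + ?c d) -` ?B (?\<tau> d)))"
  proof (rule emeasure_subadditive_finite)
    show "(\<lambda>d. (\<lambda>x. x + ?c d) -` ?B (?\<tau> d)) ` {0, 1, 2} \<subseteq> sets lborel"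
      by (intro image_subsetI meas')
  qed simp
  also have "\<dots> = (\<Sum>d\<in>{0, 1, 2}. emeasure lborel (?B (?\<tau> d)))"
    using meas by (intro sum.cong refl emeasure_lborel_translate)
  also have "\<dots> = (\<Sum>d\<in>{0, 1, 2}. emeasure lborel (?B d))"
    using sum.permute [OF permutes_swap_id [OF ab], of "\<lambda>d. emeasure lborel (?B d)"]
    by (simp only: o_def)
  also have "\<dots> = emeasure lborel (\<Union>d\<in>{0, 1, 2}. ?B d)"
    using meas by (intro sum_emeasure) (auto simp: disjoint_family_on_def)
  also have "(\<Union>d\<in>{0, 1, 2}. ?B d) = B"
    using digit_cases by blast
  finally show ?thesis .
qed

end

primrec swap_digits :: "int \<Rightarrow> int \<Rightarrow> nat \<Rightarrow> nat \<Rightarrow> real \<Rightarrow> real" where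
  "swap_digits a b n 0 x = x"
| "swap_digits a b n (Suc m) x = swap_digit a b (n + m) (swap_digits a b n m x)"

lemma
  assumes ab: "a \<in> {0, 1, 2}" "b \<in> {0, 1, 2}"
  shows floor_swap_digits: "\<lfloor>3 ^ n * swap_digits a b n m x\<rfloor> = \<lfloor>3 ^ n * x\<rfloor>"
    and frac_swap_digits: "frac (3 ^ (n + m) * swap_digits a b n m x) = frac (3 ^ (n + m) * x)"
    and digit_swap_digits: "digit i (swap_digits a b n m x) =
      (if n \<le> i \<and> i < n + m then Transposition.transpose a b (digit i x) else digit i x)"
    and borel_measurable_swap_digits: "swap_digits a b n m \<in> borel_measurable borel"
    and emeasure_swap_digits_le: "B \<in> sets borel \<Longrightarrow>
      emeasure lborel (swap_digits a b n m -` B) \<le> emeasure lborel B"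
proof -
  show "\<lfloor>3 ^ n * swap_digits a b n m x\<rfloor> = \<lfloor>3 ^ n * x\<rfloor>"
    by (induction m) (simp_all add: floor_swap_digit [OF ab])
  show digit: "digit i (swap_digits a b n m x) =
      (if n \<le> i \<and> i < n + m then Transposition.transpose a b (digit i x) else digit i x)" for i m
    by (induction m) (auto simp: digit_swap_digit_same [OF ab] digit_swap_digit_other [OF ab] less_Suc_eq)
  show "frac (3 ^ (n + m) * swap_digits a b n m x) = frac (3 ^ (n + m) * x)"
    by (rule frac_eqI_digits) (simp add: digit)
  show meas: "swap_digits a b n m \<in> borel_measurable borel" for m
  proof (induction m)
    case (Suc m)
    from measurable_compose [OF this borel_measurable_swap_digit [OF ab]]
    show ?case by simp
  qed simp
  show "emeasure lborel (swap_digits a b n m -` B) \<le> emeasure lborel B" if B: "B \<in> sets borel" for B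
    using B
  proof (induction m arbitrary: B)
    case 0
    have "swap_digits a b n 0 -` B = B" by auto
    then show ?case by simp
  next
    case (Suc m)
    have "swap_digits a b n (Suc m) -` B = swap_digits a b n m -` (swap_digit a b (n + m) -` B)"
      by auto
    moreover have "swap_digit a b (n + m) -` B \<in> sets borel"
      using measurable_sets [OF borel_measurable_swap_digit [OF ab] Suc.prems] by simp
    ultimately show ?case
      using Suc.IH emeasure_swap_digit_le [OF ab Suc.prems] order_trans by metis
  qed
qed

text \<open>The bound does not depend on the number of exchanged places, which is what allows infinitely
  many places to be controlled at once.\<close>

lemma emeasure_Union_le_of_swap:
  assumes ab: "a \<in> {0, 1, 2}" "b \<in> {0, 1, 2}" and "V \<in> sets borel" "incseq E" "range E \<subseteq> sets borel"
    and "\<And>m x. x \<in> E m \<Longrightarrow> swap_digits a b n m x \<in> V"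
  shows "emeasure lborel (\<Union>m. E m) \<le> emeasure lborel V"
proof -
  have "emeasure lborel (E m) \<le> emeasure lborel V" for m
  proof -
    have "emeasure lborel (E m) \<le> emeasure lborel (swap_digits a b n m -` V)"
      using assms(6) measurable_sets [OF borel_measurable_swap_digits [OF ab] assms(3)]
      by (intro emeasure_mono) auto
    also have "\<dots> \<le> emeasure lborel V"
      by (rule emeasure_swap_digits_le [OF ab assms(3)])
    finally show ?thesis .
  qed
  moreover have "(SUP m. emeasure lborel (E m)) = emeasure lborel (\<Union>m. E m)"
    using assms(4,5) by (intro SUP_emeasure_incseq) auto
  ultimately show ?thesis by (metis SUP_least)
qed

section \<open>Measurability of the transformation\<close>

text \<open>The transformation is a countable union of translations of levels, which gives both its
  measurability and the fact that preimages of null sets are null.\<close>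

lemma vimage_chacon_nonneg:
  "chacon -` B \<inter> {0..} = (\<Union>n. \<Union>i\<in>{i. Suc i < height n}.
     level n i \<inter> (\<lambda>x. x + (tower n ! Suc i - tower n ! i)) -` B)"
proof (intro equalityI subsetI)
  fix x assume x: "x \<in> chacon -` B \<inter> {0..}"
  then obtain n where n: "x \<in> tower_space n" "Suc (position n x) < height n"
    using eventually_below_top [of x] by auto
  then have "chacon x = x + (tower n ! Suc (position n x) - tower n ! position n x)"
    using chacon_eq [OF n(2) in_level_position [OF n(1)]] by simp
  with x n in_level_position [OF n(1)]
  show "x \<in> (\<Union>n. \<Union>i\<in>{i. Suc i < height n}.
     level n i \<inter> (\<lambda>x. x + (tower n ! Suc i - tower n ! i)) -` B)" by auto
next
  fix x assume "x \<in> (\<Union>n. \<Union>i\<in>{i. Suc i < height n}.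
     level n i \<inter> (\<lambda>x. x + (tower n ! Suc i - tower n ! i)) -` B)"
  then obtain n i where ni: "Suc i < height n" "x \<in> level n i" "x + (tower n ! Suc i - tower n ! i) \<in> B"
    by auto
  moreover have "x \<in> tower_space n"
    using ni by (intro level_imp_tower_space [of i]) auto
  ultimately show "x \<in> chacon -` B \<inter> {0..}"
    using chacon_eq [OF ni(1,2)] by (simp add: tower_space_def add_diff_eq diff_add_eq add.commute)
qed

lemma sets_level [measurable]: "level n i \<in> sets borel"
  by (simp add: level_def)

text \<open>Off the half-line the definite description is the same for all points, so the
  transformation is Borel on the whole line.\<close>

lemma chacon_neg:
  assumes "x < 0"
  shows "chacon x = (THE y. False)"
proof -
  have "x \<notin> level n i" if "Suc i < height n" for n i
    using level_imp_tower_space [of i n x] that assms by (auto simp: tower_space_def)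
  then show ?thesis
    unfolding chacon_def by (intro arg_cong [where f = The]) auto
qed

lemma borel_measurable_chacon [measurable]: "chacon \<in> borel_measurable borel"
proof (rule measurableI)
  fix B :: "real set" assume B: "B \<in> sets borel"
  have "chacon -` B \<inter> {0..} \<in> sets borel"
    unfolding vimage_chacon_nonneg
    using sets_translate [OF B] by (intro sets.countable_UN' sets.Int) auto
  moreover have "chacon -` B \<inter> {..<0} = (if (THE y. False) \<in> B then {..<0} else {})"
    using chacon_neg by auto
  moreover have "chacon -` B = chacon -` B \<inter> {0..} \<union> chacon -` B \<inter> {..<0}" by auto
  ultimately show "chacon -` B \<inter> space borel \<in> sets borel"
    by (metis Int_UNIV_right sets.Un sets.empty_sets space_borel borel_open open_lessThan)
qed simp

lemma borel_measurable_chacon_funpow [measurable]: "(chacon ^^ k) \<in> borel_measurable borel"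
  by (rule measurable_compose_n) measurable

lemma null_sets_vimage_chacon:
  assumes N: "N \<in> null_sets lborel"
  shows "chacon -` N \<inter> {0..} \<in> null_sets lborel"
  unfolding vimage_chacon_nonneg
proof (intro null_sets_UN' null_set_Int1)
  fix n i
  have "N \<in> sets borel" using N by auto
  then show "(\<lambda>x. x + (tower n ! Suc i - tower n ! i)) -` N \<in> null_sets lborel"
    using N emeasure_lborel_translate [of N] sets_translate [of N]
    by (auto simp: null_sets_def)
qed auto

lemma AE_chacon:
  assumes "AE x in lborel. 0 \<le> x \<longrightarrow> P x"
  shows "AE x in lborel. 0 \<le> x \<longrightarrow> P (chacon x)"
proof -
  obtain N where N: "{x \<in> space lborel. \<not> (0 \<le> x \<longrightarrow> P x)} \<subseteq> N" "N \<in> null_sets lborel"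
    using assms by (auto elim!: AE_E simp: null_sets_def)
  show ?thesis
    using N(1) chacon_nonneg by (intro AE_I' [OF null_sets_vimage_chacon [OF N(2)]]) auto
qed

lemma AE_chacon_funpow:
  assumes "AE x in lborel. 0 \<le> x \<longrightarrow> P x"
  shows "AE x in lborel. 0 \<le> x \<longrightarrow> (\<forall>k. P ((chacon ^^ k) x))"
proof -
  have "AE x in lborel. 0 \<le> x \<longrightarrow> P ((chacon ^^ k) x)" for k
  proof (induction k)
    case (Suc k)
    from AE_chacon [OF this] show ?case by (simp add: funpow_swap1)
  qed (use assms in simp)
  then have "AE x in lborel. \<forall>k. 0 \<le> x \<longrightarrow> P ((chacon ^^ k) x)"
    by (subst AE_all_countable) blast
  then show ?thesis by auto
qed

section \<open>Density of sets in levels, and ergodicity\<close>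

lemma emeasure_level: "emeasure lborel (level n i) = ennreal (1 / 3 ^ n)"
  by (simp add: level_def)

lemma level_Suc_subset:
  assumes "i < height n" "x \<in> level n i"
  shows "level (Suc n) (i + shift n (digit n x)) \<subseteq> level n i"
proof
  let ?j = "i + shift n (digit n x)"
  have j: "?j < height (Suc n)" using shift_less_height [OF assms(1)] Suc_lessD by blast
  fix y assume "y \<in> level (Suc n) ?j"
  then have "real_of_int \<lfloor>3 ^ Suc n * y\<rfloor> = real_of_int \<lfloor>3 ^ Suc n * x\<rfloor>"
    using mem_level_iff [OF j] level_Suc [OF assms] by metis
  then have "\<lfloor>3 ^ n * y\<rfloor> = \<lfloor>3 ^ n * x\<rfloor>"
    using floor_eq_mono [of "Suc n" y x n] by simp
  with assms show "y \<in> level n i"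
    using mem_level_iff [OF assms(1)] by simp
qed

lemma disjoint_levels: "disjoint_family_on (level n) {..<height n}"
  using level_unique by (auto simp: disjoint_family_on_def)

definition levels_within :: "nat \<Rightarrow> real set \<Rightarrow> real set" where
  "levels_within n U = (\<Union>i\<in>{i. i < height n \<and> level n i \<subseteq> U}. level n i)"

lemma incseq_levels_within: "incseq (\<lambda>n. levels_within n U)"
proof (rule incseq_SucI, rule subsetI)
  fix n x assume "x \<in> levels_within n U"
  then obtain i where i: "i < height n" "level n i \<subseteq> U" "x \<in> level n i"
    by (auto simp: levels_within_def)
  then have "level (Suc n) (i + shift n (digit n x)) \<subseteq> U"
    using level_Suc_subset by blast
  then show "x \<in> levels_within (Suc n) U"
    unfolding levels_within_def
    using level_Suc [OF i(1,3)] shift_less_height [OF i(1), THEN Suc_lessD] by blast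
qed

lemma open_subset_levels_within:
  assumes "open U"
  shows "U \<inter> {0..} \<subseteq> (\<Union>n. levels_within n U)"
proof
  fix x assume x: "x \<in> U \<inter> {0..}"
  then obtain e where e: "e > 0" "ball x e \<subseteq> U" using assms openE by blast
  obtain m where m: "(1 / 3) ^ m < e" using real_arch_pow_inv [OF e(1), of "1 / 3"] by auto
  obtain k where k: "x \<in> tower_space k" using eventually_in_tower_space x by auto
  define n where "n = max k m"
  have n: "x \<in> tower_space n" using k tower_space_mono [of k n] by (auto simp: n_def)
  have "(1 / 3 :: real) ^ n \<le> (1 / 3) ^ m"
    by (intro power_decreasing) (auto simp: n_def)
  with m have "1 / 3 ^ n < e" by (simp add: power_divide)
  then have "level n (position n x) \<subseteq> ball x e"
    using in_level_position [OF n] by (auto simp: level_def dist_real_def)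
  then have "x \<in> levels_within n U"
    using e position_less [OF n] in_level_position [OF n] by (auto simp: levels_within_def)
  then show "x \<in> (\<Union>n. levels_within n U)" by blast
qed

lemma sets_levels_within [measurable]: "levels_within n U \<in> sets borel"
  unfolding levels_within_def by (intro sets.finite_UN) auto

text \<open>An open set \<open>U\<close> that approximates \<open>F\<close> from outside is exhausted by the levels that it contains.
  If \<open>F\<close> missed a proportion \<open>e\<close> of each of these levels, it would miss about this proportion of
  \<open>U\<close>.\<close>

lemma dense_level_finite:
  fixes e :: real
  assumes F: "F \<in> sets borel" "F \<subseteq> {0..}" "emeasure lborel F = ennreal r" "r > 0" and "e > 0"
  shows "\<exists>n0. \<forall>n\<ge>n0. \<exists>i<height n. emeasure lborel (level n i - F) < ennreal (e / 3 ^ n)"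
proof -
  obtain U where U: "open U" "F \<subseteq> U" "emeasure lborel (U - F) < ennreal (e * r)"
    using outer_regular_lborel [OF F(1), of "e * r"] \<open>r > 0\<close> \<open>e > 0\<close> by auto
  then obtain q where q: "emeasure lborel (U - F) = ennreal q" "0 \<le> q"
    by (cases "emeasure lborel (U - F)") auto
  with U have "q < e * r" by (simp add: ennreal_less_iff)
  then have "ennreal (q / e) < ennreal r"
    using \<open>e > 0\<close> \<open>r > 0\<close> q by (simp add: ennreal_less_iff field_simps)
  also have "ennreal r \<le> emeasure lborel (\<Union>n. levels_within n U)"
    unfolding F(3) [symmetric] using F U open_subset_levels_within [OF U(1)]
    by (intro emeasure_mono) auto
  also have "\<dots> = (SUP n. emeasure lborel (levels_within n U))"
    by (intro SUP_emeasure_incseq [symmetric] incseq_levels_within) auto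
  finally obtain n0 where n0: "ennreal (q / e) < emeasure lborel (levels_within n0 U)"
    by (auto simp: less_SUP_iff)
  have "\<exists>i<height n. emeasure lborel (level n i - F) < ennreal (e / 3 ^ n)" if "n \<ge> n0" for n
  proof (rule ccontr)
    assume contra: "\<not> ?thesis"
    have large: "ennreal (e / 3 ^ n) \<le> emeasure lborel (level n i - F)" if "i < height n" for i
    proof (rule ccontr)
      assume "\<not> ennreal (e / 3 ^ n) \<le> emeasure lborel (level n i - F)"
      then have "emeasure lborel (level n i - F) < ennreal (e / 3 ^ n)" by (rule not_le_imp_less)
      with that contra show False by blast
    qed
    let ?I = "{i. i < height n \<and> level n i \<subseteq> U}"
    have disj: "disjoint_family_on (level n) ?I" "disjoint_family_on (\<lambda>i. level n i - F) ?I"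
      using disjoint_levels [of n] by (auto simp: disjoint_family_on_def)
    have "ennreal (q / e) < emeasure lborel (levels_within n U)"
      using n0 emeasure_mono [of "levels_within n0 U" "levels_within n U" lborel]
        monoD [OF incseq_levels_within that] by auto
    also have "\<dots> = (\<Sum>i\<in>?I. emeasure lborel (level n i))"
      unfolding levels_within_def using disj by (intro sum_emeasure [symmetric]) auto
    also have "\<dots> = ennreal (real (card ?I) / 3 ^ n)"
      by (simp add: emeasure_level ennreal_of_nat_eq_real_of_nat ennreal_mult' [symmetric])
    finally have "q / e < real (card ?I) / 3 ^ n"
      using q \<open>e > 0\<close> by (simp add: ennreal_less_iff)
    then have "q < real (card ?I) * (e / 3 ^ n)"
      using \<open>e > 0\<close> by (simp add: field_simps)
    then have "ennreal q < ennreal (real (card ?I) * (e / 3 ^ n))"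
      using q by (simp add: ennreal_less_iff)
    also have "ennreal (real (card ?I) * (e / 3 ^ n)) = (\<Sum>i\<in>?I. ennreal (e / 3 ^ n))"
      using \<open>e > 0\<close> by (simp add: ennreal_of_nat_eq_real_of_nat ennreal_mult' [symmetric])
    also have "\<dots> \<le> (\<Sum>i\<in>?I. emeasure lborel (level n i - F))"
      using large by (intro sum_mono) simp
    also have "\<dots> = emeasure lborel (\<Union>i\<in>?I. level n i - F)"
      using disj F by (intro sum_emeasure) auto
    also have "\<dots> \<le> emeasure lborel (U - F)"
      using F U by (intro emeasure_mono) auto
    finally show False using q by simp
  qed
  then show ?thesis by blast
qed

lemma dense_level:
  fixes e :: real
  assumes F: "F \<in> sets borel" "F \<subseteq> {0..}" "emeasure lborel F \<noteq> 0" and "e > 0"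
  shows "\<exists>n0. \<forall>n\<ge>n0. \<exists>i<height n. emeasure lborel (level n i - F) < ennreal (e / 3 ^ n)"
proof -
  have "F = (\<Union>m. F \<inter> {0..<real m})"
    using F(2) reals_Archimedean2 by (auto simp: subset_iff)
  then have "\<exists>m. F \<inter> {0..<real m} \<notin> null_sets lborel"
    using F null_sets_UN [of "\<lambda>m. F \<inter> {0..<real m}" lborel] by (metis null_setsD1)
  then obtain m where m: "emeasure lborel (F \<inter> {0..<real m}) \<noteq> 0"
    using F by (auto simp: null_sets_def)
  have "emeasure lborel (F \<inter> {0..<real m}) \<le> emeasure lborel {0..<real m}"
    by (intro emeasure_mono) auto
  also have "\<dots> < \<infinity>" by simp
  finally obtain r where r: "emeasure lborel (F \<inter> {0..<real m}) = ennreal r" "0 \<le> r"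
    by (cases "emeasure lborel (F \<inter> {0..<real m})") auto
  with m have "r > 0" by (cases "r = 0") auto
  have "\<exists>n0. \<forall>n\<ge>n0. \<exists>i<height n.
      emeasure lborel (level n i - F \<inter> {0..<real m}) < ennreal (e / 3 ^ n)"
    using F by (intro dense_level_finite [OF _ _ r(1) \<open>r > 0\<close> \<open>e > 0\<close>]) auto
  then obtain n0 where n0: "\<forall>n\<ge>n0. \<exists>i<height n.
      emeasure lborel (level n i - F \<inter> {0..<real m}) < ennreal (e / 3 ^ n)" ..
  have "emeasure lborel (level n i - F) \<le> emeasure lborel (level n i - F \<inter> {0..<real m})" for n i
    using F by (intro emeasure_mono) auto
  then show ?thesis
    using n0 by (meson le_less_trans)
qed

text \<open>A power of the transformation translates one level of a tower onto another, so an invariant set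
  fills all levels of a tower in the same proportion.\<close>

lemma emeasure_level_diff_invariant:
  assumes K: "K \<in> sets borel" and inv: "AE x in lborel. 0 \<le> x \<longrightarrow> (chacon x \<in> K \<longleftrightarrow> x \<in> K)"
    and ij: "i + k < height n"
  shows "emeasure lborel (level n (i + k) - K) = emeasure lborel (level n i - K)"
proof -
  define c where "c = tower n ! (i + k) - tower n ! i"
  have shift: "(chacon ^^ k) x = x + c \<and> 0 \<le> x" if "x \<in> level n i" for x
  proof -
    have x: "x \<in> tower_space n" "position n x = i"
      using that ij level_imp_tower_space [of i n x] position_eqI [of i n x] by auto
    let ?y = "tower n ! (i + k) + frac (3 ^ n * x) / 3 ^ n"
    note y = position_and_frac_eqI [OF ij frac_ge_0 frac_lt_1, of ?y]
    have "?y = (chacon ^^ k) x"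
      using x y by (intro chacon_funpow_eqI [of x n]) auto
    with eq_tower_plus_frac [OF x(1)] x show ?thesis by (simp add: tower_space_def c_def)
  qed
  have "AE x in lborel. 0 \<le> x \<longrightarrow> (\<forall>k. chacon ((chacon ^^ k) x) \<in> K \<longleftrightarrow> (chacon ^^ k) x \<in> K)"
    by (rule AE_chacon_funpow [OF inv])
  then have AE_inv: "AE x in lborel. 0 \<le> x \<longrightarrow> ((chacon ^^ k) x \<in> K \<longleftrightarrow> x \<in> K)"
  proof (rule AE_mp, intro AE_I2 impI)
    fix x assume "0 \<le> x \<longrightarrow> (\<forall>k. chacon ((chacon ^^ k) x) \<in> K \<longleftrightarrow> (chacon ^^ k) x \<in> K)" "0 \<le> x"
    then have "chacon ((chacon ^^ k) x) \<in> K \<longleftrightarrow> (chacon ^^ k) x \<in> K" for k by blast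
    then show "(chacon ^^ k) x \<in> K \<longleftrightarrow> x \<in> K" by (induction k) auto
  qed
  have lev: "x + c \<in> level n (i + k) \<longleftrightarrow> x \<in> level n i" for x
    by (auto simp: level_def c_def)
  have "emeasure lborel (level n (i + k) - K) = emeasure lborel ((\<lambda>x. x + c) -` (level n (i + k) - K))"
    using K by (intro emeasure_lborel_translate [symmetric]) auto
  also have "\<dots> = emeasure lborel (level n i - K)"
  proof (rule emeasure_eq_AE)
    show "AE x in lborel. x \<in> (\<lambda>x. x + c) -` (level n (i + k) - K) \<longleftrightarrow> x \<in> level n i - K"
      using AE_inv
    proof (rule AE_mp, intro AE_I2 impI)
      fix x assume "0 \<le> x \<longrightarrow> ((chacon ^^ k) x \<in> K \<longleftrightarrow> x \<in> K)"
      then show "x \<in> (\<lambda>x. x + c) -` (level n (i + k) - K) \<longleftrightarrow> x \<in> level n i - K"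
        using shift [of x] lev [of x] by auto
    qed
    show "(\<lambda>x. x + c) -` (level n (i + k) - K) \<in> sets lborel"
      using sets_translate [of "level n (i + k) - K" "c"] K by auto
    show "level n i - K \<in> sets lborel" using K by auto
  qed
  finally show ?thesis .
qed

text \<open>If an invariant set and its complement both had positive measure, then in a high tower each of
  them would fill more than half of some level, hence of every level.\<close>

lemma chacon_ergodic:
  assumes K: "K \<in> sets borel" and inv: "AE x in lborel. 0 \<le> x \<longrightarrow> (chacon x \<in> K \<longleftrightarrow> x \<in> K)"
    and pos: "emeasure lborel (K \<inter> {0..}) \<noteq> 0"
  shows "AE x in lborel. 0 \<le> x \<longrightarrow> x \<in> K"
proof (rule ccontr)
  assume not: "\<not> ?thesis"
  let ?L = "{0..} - K"
  have "emeasure lborel ?L \<noteq> 0"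
  proof
    assume "emeasure lborel ?L = 0"
    then have "?L \<in> null_sets lborel" using K by (auto simp: null_sets_def)
    then have "AE x in lborel. 0 \<le> x \<longrightarrow> x \<in> K" by (rule AE_I') auto
    with not show False ..
  qed
  then obtain n1 where n1: "\<forall>n\<ge>n1. \<exists>i<height n. emeasure lborel (level n i - ?L) < ennreal (1 / 2 / 3 ^ n)"
    using dense_level [of ?L "1 / 2"] K by auto
  obtain n2 where n2: "\<forall>n\<ge>n2. \<exists>i<height n. emeasure lborel (level n i - K \<inter> {0..}) < ennreal (1 / 2 / 3 ^ n)"
    using dense_level [of "K \<inter> {0..}" "1 / 2"] K pos by auto
  define n where "n = max n1 n2"
  obtain i where i: "i < height n" "emeasure lborel (level n i - ?L) < ennreal (1 / 2 / 3 ^ n)"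
    using n1 unfolding n_def by (meson max.cobounded1)
  obtain j where j: "j < height n" "emeasure lborel (level n j - K \<inter> {0..}) < ennreal (1 / 2 / 3 ^ n)"
    using n2 unfolding n_def by (meson max.cobounded2)
  have nonneg: "level n i \<subseteq> {0..}" if "i < height n" for i
    using level_imp_tower_space [OF that] by (auto simp: tower_space_def)
  have "emeasure lborel (level n j - K) = emeasure lborel (level n i - K)"
    using emeasure_level_diff_invariant [OF K inv, of i "j - i" n]
      emeasure_level_diff_invariant [OF K inv, of j "i - j" n] i j by (cases "i \<le> j") auto
  then have "emeasure lborel (level n i - K) < ennreal (1 / 2 / 3 ^ n)"
    using j(2) nonneg [OF j(1)] by (metis Diff_Int Diff_eq_empty_iff Un_empty_right)
  moreover have "level n i - ?L = level n i \<inter> K"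
    using nonneg [OF i(1)] by auto
  ultimately have "emeasure lborel (level n i \<inter> K) + emeasure lborel (level n i - K)
      < ennreal (1 / 2 / 3 ^ n + 1 / 2 / 3 ^ n)"
    using i(2) by (intro add_mono_ennreal) auto
  also have "\<dots> = emeasure lborel (level n i)"
    by (simp add: emeasure_level)
  also have "\<dots> = emeasure lborel (level n i \<inter> K) + emeasure lborel (level n i - K)"
    using K by (subst plus_emeasure) (auto intro: arg_cong2 [where f = emeasure])
  finally show False by simp
qed

section \<open>Commuting maps preserve digits\<close>

lemma same_translate_of_commuting:
  assumes "y \<in> tower_space n" "y' \<in> tower_space n" "frac (3 ^ n * y) = frac (3 ^ n * y')"
    and "\<And>k. S ((chacon ^^ k) y) = (chacon ^^ k) (S y)"
    and "\<And>k. S ((chacon ^^ k) y') = (chacon ^^ k) (S y')"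
  shows "same_translate y y' (S y) (S y')"
proof (cases "position n y \<le> position n y'")
  case True
  then have "y' = (chacon ^^ (position n y' - position n y)) y"
    using assms(1-3) by (intro chacon_funpow_eqI [of y n]) auto
  then show ?thesis unfolding same_translate_def using assms(4) by metis
next
  case False
  then have "y = (chacon ^^ (position n y - position n y')) y'"
    using assms(1-3) by (intro chacon_funpow_eqI [of y' n]) auto
  then show ?thesis unfolding same_translate_def using assms(5) by metis
qed

lemma emeasure_le_of_cover:
  assumes "A \<subseteq> B \<union> C" "B \<in> sets M" "C \<in> sets M"
    "emeasure M B \<le> ennreal x" "emeasure M C \<le> ennreal y" "0 \<le> x" "0 \<le> y"
  shows "emeasure M A \<le> ennreal (x + y)"
proof -
  have "emeasure M A \<le> emeasure M (B \<union> C)" using assms by (intro emeasure_mono) auto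
  also have "\<dots> \<le> emeasure M B + emeasure M C" using assms by (intro emeasure_subadditive)
  also have "\<dots> \<le> ennreal x + ennreal y" using assms by (intro add_mono)
  finally show ?thesis using assms by simp
qed

lemma swap_digits_in_level:
  assumes i: "i < height n" and x: "x \<in> level n i" and ab: "a \<in> {0, 1, 2}" "b \<in> {0, 1, 2}"
  shows "swap_digits a b n m x \<in> level n i"
    and "x \<in> tower_space n" "swap_digits a b n m x \<in> tower_space n"
    and "position n x = position n (swap_digits a b n m x)"
proof -
  let ?y = "swap_digits a b n m x"
  show y: "?y \<in> level n i"
    using x mem_level_iff [OF i] floor_swap_digits [OF ab] by simp
  show "x \<in> tower_space n" "?y \<in> tower_space n"
    using x y level_imp_tower_space [OF i] by auto
  show "position n x = position n ?y"
    using position_eqI [OF i x] position_eqI [OF i y] by simp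
qed

text \<open>Every place beyond \<open>n\<close> must be controlled on a single set of positive measure. Exchanging one place
  at a time would give an exceptional set of fixed measure for each place, and these do not add up
  to less than the level; so all places up to a bound are exchanged simultaneously.
  The exceptional sets take up at most \<open>1 + 1\<close> fifths of the level after exchanging \<open>0\<close> and \<open>2\<close>,
  and \<open>2 + 2\<close> fifths after exchanging \<open>0\<close> and \<open>1\<close>, which is why the density must exceed
  four fifths.\<close>

lemma agreement_on_nonnull_set:
  fixes S :: "real \<Rightarrow> real"
  assumes S [measurable]: "S \<in> borel_measurable borel"
    and F [measurable]: "F \<in> sets borel" and i: "i < height n"
    and range: "\<And>x. x \<in> F \<Longrightarrow> S x \<in> {0..<1}"
    and comm: "\<And>x k. x \<in> F \<Longrightarrow> S ((chacon ^^ k) x) = (chacon ^^ k) (S x)"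
    and dense: "emeasure lborel (level n i - F) < ennreal (1 / 5 / 3 ^ n)"
  shows "emeasure lborel {x \<in> level n i \<inter> F. \<forall>j\<ge>n. digit j (S x) = digit j x} \<noteq> 0"
proof -
  let ?I = "level n i"
  define w where "w = (1 / 5 / 3 ^ n :: real)"
  have w: "0 < w" by (simp add: w_def)
  \<comment> \<open>\<open>G\<close> is what the first exchange leaves, and \<open>H\<close> what the second one leaves; \<open>D m\<close> and \<open>E m\<close> are
    the points where the digit exchange on \<open>m\<close> places detects a disagreement.\<close>
  define G where "G = {x \<in> ?I \<inter> F. \<forall>j\<ge>n. digit j x \<noteq> 1 \<longrightarrow> digit j (S x) = digit j x}"
  define H where "H = {x \<in> ?I \<inter> F. \<forall>j\<ge>n. digit j (S x) = digit j x}"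
  define D where "D m = {x \<in> ?I \<inter> F. \<exists>j\<in>{n..<n + m}. digit j x \<noteq> 1 \<and> digit j (S x) \<noteq> digit j x}" for m
  define E where "E m = {x \<in> G. \<exists>j\<in>{n..<n + m}. digit j (S x) \<noteq> digit j x}" for m
  have [measurable]: "G \<in> sets borel" "H \<in> sets borel" "D m \<in> sets borel" for m
    unfolding G_def H_def D_def by measurable
  have [measurable]: "E m \<in> sets borel" for m
    unfolding E_def by measurable
  have translate: "same_translate x (swap_digits a b n m x) (S x) (S (swap_digits a b n m x))"
    if "x \<in> ?I" "a \<in> {0, 1, 2}" "b \<in> {0, 1, 2}" "x \<in> F" "swap_digits a b n m x \<in> F" for a b x m
    using that swap_digits_in_level [OF i that(1-3)] tower_space_mono [of n "n + m"]
      frac_swap_digits [OF that(2,3), of n m x] comm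
    by (intro same_translate_of_commuting [of x "n + m"]) auto
  have "emeasure lborel (\<Union>m. D m) \<le> emeasure lborel (?I - F)"
  proof (rule emeasure_Union_le_of_swap [of 0 2 _ _ n])
    show "incseq D" unfolding D_def by (rule incseq_SucI) fastforce
    fix m x assume "x \<in> D m"
    then obtain j where x: "x \<in> ?I" "x \<in> F" and j: "n \<le> j" "j < n + m"
        "digit j x \<noteq> 1" "digit j (S x) \<noteq> digit j x"
      by (auto simp: D_def)
    have ab: "(0::int) \<in> {0, 1, 2}" "(2::int) \<in> {0, 1, 2}" by auto
    note sw = swap_digits_in_level [OF i x(1) ab]
    let ?y = "swap_digits 0 2 n m x"
    have "?y \<notin> F"
    proof
      assume y: "?y \<in> F"
      have "digit j (S x) = digit j x"
      proof (rule swap_02_transfers_digit [of x n ?y])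
        show "same_translate x ?y (S x) (S ?y)" by (rule translate [OF x(1) ab x(2) y])
      qed (use sw(2-4) y x range j digit_swap_digits [OF ab] in auto)
      with j show False by simp
    qed
    with sw(1) [of m] show "?y \<in> ?I - F" by auto
  qed auto
  then have "emeasure lborel (\<Union>m. D m) \<le> ennreal w"
    using dense by (simp add: w_def)
  moreover have "?I - G \<subseteq> (?I - F) \<union> (\<Union>m. D m)"
  proof
    fix x assume x: "x \<in> ?I - G"
    show "x \<in> (?I - F) \<union> (\<Union>m. D m)"
    proof (cases "x \<in> F")
      case True
      with x obtain j where "n \<le> j" "digit j x \<noteq> 1" "digit j (S x) \<noteq> digit j x"
        by (auto simp: G_def)
      with x True have "x \<in> D (Suc (j - n))" by (auto simp: D_def)
      then show ?thesis by blast
    qed (use x in auto)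
  qed
  ultimately have IG: "emeasure lborel (?I - G) \<le> ennreal (w + w)"
    using dense w by (intro emeasure_le_of_cover [of _ "?I - F" "\<Union>m. D m" _ w w]) (auto simp: w_def)
  have "emeasure lborel (\<Union>m. E m) \<le> emeasure lborel (?I - G)"
  proof (rule emeasure_Union_le_of_swap [of 0 1 _ _ n])
    show "incseq E" unfolding E_def by (rule incseq_SucI) fastforce
    fix m x assume "x \<in> E m"
    then obtain j where x: "x \<in> ?I" "x \<in> F" "x \<in> G" and j: "n \<le> j" "j < n + m"
        "digit j (S x) \<noteq> digit j x"
      by (auto simp: E_def G_def)
    have ab: "(0::int) \<in> {0, 1, 2}" "(1::int) \<in> {0, 1, 2}" by auto
    note sw = swap_digits_in_level [OF i x(1) ab]
    let ?y = "swap_digits 0 1 n m x"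
    have "?y \<notin> G"
    proof
      assume y: "?y \<in> G"
      then have yF: "?y \<in> F" by (simp add: G_def)
      have "digit j (S x) = digit j x"
      proof (rule swap_01_transfers_digit [of x n ?y])
        show "same_translate x ?y (S x) (S ?y)" by (rule translate [OF x(1) ab x(2) yF])
        show "digit k (S x) = digit k x" if "n \<le> k" "digit k x \<noteq> 1" for k
          using x(3) that by (simp add: G_def)
        show "digit k (S ?y) = digit k ?y" if "n \<le> k" "digit k ?y \<noteq> 1" for k
          using y that by (simp add: G_def)
      qed (use sw(2-4) yF x range j digit_swap_digits [OF ab] in auto)
      with j show False by simp
    qed
    with sw(1) [of m] show "?y \<in> ?I - G" by auto
  qed auto
  then have "emeasure lborel (\<Union>m. E m) \<le> ennreal (w + w)"
    using IG by (rule order_trans)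
  moreover have "?I - H \<subseteq> (?I - G) \<union> (\<Union>m. E m)"
  proof
    fix x assume x: "x \<in> ?I - H"
    show "x \<in> (?I - G) \<union> (\<Union>m. E m)"
    proof (cases "x \<in> G")
      case True
      with x obtain j where "n \<le> j" "digit j (S x) \<noteq> digit j x"
        by (auto simp: G_def H_def)
      with True have "x \<in> E (Suc (j - n))" by (auto simp: E_def)
      then show ?thesis by blast
    qed (use x in auto)
  qed
  ultimately have IH: "emeasure lborel (?I - H) \<le> ennreal ((w + w) + (w + w))"
    using IG w by (intro emeasure_le_of_cover [of _ "?I - G" "\<Union>m. E m" _ "w + w" "w + w"]) auto
  have "emeasure lborel H \<noteq> 0"
  proof
    assume "emeasure lborel H = 0"
    then have "H \<in> null_sets lborel" by (simp add: null_sets_def)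
    then have "emeasure lborel (?I - H) = emeasure lborel ?I"
      by (intro emeasure_Diff_null_set) auto
    also have "\<dots> = ennreal (5 * w)" by (simp add: emeasure_level w_def)
    finally show False using IH w by simp
  qed
  then show ?thesis by (simp add: H_def)
qed

text \<open>Applying the transformation on both sides avoids a case distinction on which of the points
  lies lower in the tower.\<close>

lemma same_digits_imp_same_orbit:
  assumes "x \<in> tower_space n" "y \<in> tower_space n" "\<And>j. n \<le> j \<Longrightarrow> digit j x = digit j y"
  shows "(chacon ^^ position n y) x = (chacon ^^ position n x) y"
proof -
  have *: "(chacon ^^ position n y) x = (chacon ^^ position n x) y"
    if "x \<in> tower_space n" "y \<in> tower_space n" "frac (3 ^ n * x) = frac (3 ^ n * y)"
       "position n x \<le> position n y" for x y
  proof -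
    have "y = (chacon ^^ (position n y - position n x)) x"
      using that by (intro chacon_funpow_eqI [of x n]) auto
    then have "(chacon ^^ position n x) y = (chacon ^^ (position n x + (position n y - position n x))) x"
      by (simp add: funpow_add)
    then show ?thesis using that by simp
  qed
  have "frac (3 ^ n * x) = frac (3 ^ n * y)"
    using assms(3) by (rule frac_eqI_digits)
  then show ?thesis
    using * [of x y] * [of y x] assms(1,2) by (cases "position n x \<le> position n y") auto
qed

text \<open>From one level to the whole space: the equation found on a set of positive measure has one of
  countably many shapes, and for each shape the set where it holds is invariant.\<close>

lemma commuting_map_follows_orbits:
  fixes S :: "real \<Rightarrow> real"
  assumes S [measurable]: "S \<in> borel_measurable borel"
    and nonneg: "\<And>x. 0 \<le> x \<Longrightarrow> 0 \<le> S x"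
    and nonnull: "emeasure lborel {x. 0 \<le> x \<and> S x < 1} \<noteq> 0"
    and comm: "AE x in lborel. 0 \<le> x \<longrightarrow> S (chacon x) = chacon (S x)"
  shows "\<exists>p q. AE x in lborel. 0 \<le> x \<longrightarrow> (chacon ^^ p) (S x) = (chacon ^^ q) x"
proof -
  have comm': "AE x in lborel. 0 \<le> x \<longrightarrow> (\<forall>k. S ((chacon ^^ k) x) = (chacon ^^ k) (S x))"
    using AE_chacon_funpow [OF comm]
  proof (rule AE_mp, intro AE_I2 impI allI)
    fix x k assume "0 \<le> x \<longrightarrow> (\<forall>k. S (chacon ((chacon ^^ k) x)) = chacon (S ((chacon ^^ k) x)))" "0 \<le> x"
    then have "S (chacon ((chacon ^^ k) x)) = chacon (S ((chacon ^^ k) x))" for k by blast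
    then show "S ((chacon ^^ k) x) = (chacon ^^ k) (S x)" by (induction k) auto
  qed
  then obtain N where N: "{x \<in> space lborel. \<not> (0 \<le> x \<longrightarrow> (\<forall>k. S ((chacon ^^ k) x) = (chacon ^^ k) (S x)))} \<subseteq> N"
      "emeasure lborel N = 0" "N \<in> sets lborel"
    by (rule AE_E)
  define F where "F = {x. 0 \<le> x \<and> S x < 1} - N"
  have [measurable]: "N \<in> sets borel" using N by simp
  have [measurable]: "F \<in> sets borel" unfolding F_def by measurable
  have "emeasure lborel F = emeasure lborel {x. 0 \<le> x \<and> S x < 1}"
    unfolding F_def using N by (intro emeasure_Diff_null_set) (auto simp: null_sets_def)
  with nonnull have "emeasure lborel F \<noteq> 0" by simp
  moreover have "F \<subseteq> {0..}" by (auto simp: F_def)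
  ultimately have "\<exists>n0. \<forall>n\<ge>n0. \<exists>i<height n. emeasure lborel (level n i - F) < ennreal (1 / 5 / 3 ^ n)"
    by (intro dense_level) auto
  then obtain n i where i: "i < height n" "emeasure lborel (level n i - F) < ennreal (1 / 5 / 3 ^ n)"
    by blast
  have range: "S x \<in> {0..<1}" if "x \<in> F" for x
    using that nonneg by (auto simp: F_def)
  have commF: "S ((chacon ^^ k) x) = (chacon ^^ k) (S x)" if "x \<in> F" for x k
    using that N(1) by (auto simp: F_def)
  define H where "H = {x \<in> level n i \<inter> F. \<forall>j\<ge>n. digit j (S x) = digit j x}"
  have H: "emeasure lborel H \<noteq> 0"
    unfolding H_def by (rule agreement_on_nonnull_set [OF S _ i(1) range commF i(2)]) auto
  define K where "K q = {x. 0 \<le> x \<and> (chacon ^^ i) (S x) = (chacon ^^ q) x}" for q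
  have [measurable]: "K q \<in> sets borel" for q
    unfolding K_def by measurable
  have "H \<subseteq> (\<Union>q. K q)"
  proof
    fix x assume x: "x \<in> H"
    then have "x \<in> tower_space n" "position n x = i"
      using level_imp_tower_space [OF i(1)] position_eqI [OF i(1)] by (auto simp: H_def)
    moreover have "S x \<in> tower_space 0"
      using x range by (auto simp: H_def tower_space_def)
    then have "S x \<in> tower_space n" using tower_space_mono [of 0 n] by auto
    ultimately have "(chacon ^^ i) (S x) = (chacon ^^ position n (S x)) x"
      using same_digits_imp_same_orbit [of "S x" n x] x by (auto simp: H_def)
    then have "x \<in> K (position n (S x))"
      using \<open>x \<in> tower_space n\<close> by (simp add: K_def tower_space_def)
    then show "x \<in> (\<Union>q. K q)" by blast
  qed
  then have "(\<Union>q. K q) \<notin> null_sets lborel"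
    using H by (metis emeasure_eq_0 null_setsD1 null_setsD2)
  then have "\<exists>q. K q \<notin> null_sets lborel"
    using null_sets_UN by blast
  then obtain q where q: "emeasure lborel (K q) \<noteq> 0"
    by (auto simp: null_sets_def)
  have K_nonneg: "K q \<inter> {0..} = K q" by (auto simp: K_def)
  have "AE x in lborel. 0 \<le> x \<longrightarrow> (chacon x \<in> K q \<longleftrightarrow> x \<in> K q)"
    using comm
  proof (rule AE_mp, intro AE_I2 impI)
    fix x assume "0 \<le> x \<longrightarrow> S (chacon x) = chacon (S x)" and x: "0 \<le> x"
    then have "(chacon ^^ i) (S (chacon x)) = chacon ((chacon ^^ i) (S x))"
      by (simp add: funpow_swap1)
    moreover have "(chacon ^^ q) (chacon x) = chacon ((chacon ^^ q) x)"
      by (simp add: funpow_swap1)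
    ultimately have "(chacon ^^ i) (S (chacon x)) = (chacon ^^ q) (chacon x) \<longleftrightarrow>
        (chacon ^^ i) (S x) = (chacon ^^ q) x"
      using inj_on_chacon x nonneg by (simp add: inj_on_eq_iff chacon_funpow_nonneg)
    then show "chacon x \<in> K q \<longleftrightarrow> x \<in> K q"
      using x chacon_nonneg by (simp add: K_def)
  qed
  then have "AE x in lborel. 0 \<le> x \<longrightarrow> x \<in> K q"
    using q K_nonneg by (intro chacon_ergodic) auto
  then have "AE x in lborel. 0 \<le> x \<longrightarrow> (chacon ^^ i) (S x) = (chacon ^^ q) x"
    by (rule AE_mp) (auto simp: K_def)
  then show ?thesis by blast
qed

lemma inv_into_chacon_funpow:
  assumes "0 \<le> x"
  shows "(inv_into {0..} chacon ^^ k) ((chacon ^^ k) x) = x"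
proof (induction k)
  case (Suc k)
  have "inv_into {0..} chacon ((chacon ^^ Suc k) x) = (chacon ^^ k) x"
    using inv_into_f_f [OF inj_on_chacon] chacon_funpow_nonneg [OF assms, of k] by simp
  with Suc show ?case by (simp add: funpow_swap1)
qed simp

lemma chacon_power_eqI:
  assumes "0 \<le> x" "0 \<le> y" "(chacon ^^ p) y = (chacon ^^ q) x"
  shows "y = chacon_power (int q - int p) x"
proof (cases "p \<le> q")
  case True
  then have "(chacon ^^ p) y = (chacon ^^ p) ((chacon ^^ (q - p)) x)"
    using assms(3) by (simp flip: funpow_add[THEN fun_cong, unfolded o_apply])
  then have "y = (chacon ^^ (q - p)) x"
    using assms by (simp add: chacon_funpow_inject chacon_funpow_nonneg)
  with True show ?thesis by (simp add: chacon_power_def nat_diff_distrib)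
next
  case False
  then have "(chacon ^^ q) ((chacon ^^ (p - q)) y) = (chacon ^^ q) x"
    using assms(3) by (simp flip: funpow_add[THEN fun_cong, unfolded o_apply])
  then have "x = (chacon ^^ (p - q)) y"
    using assms by (simp add: chacon_funpow_inject chacon_funpow_nonneg)
  with False show ?thesis
    using inv_into_chacon_funpow [OF assms(2), of "p - q"]
    by (simp add: chacon_power_def nat_diff_distrib)
qed

theorem proposition4p2:
  fixes S :: "real \<Rightarrow> real"
  assumes "S \<in> chacon_measure \<rightarrow>\<^sub>M chacon_measure"
    and "\<forall>A \<in> sets chacon_measure.
           emeasure chacon_measure (S -` A \<inter> space chacon_measure) = emeasure chacon_measure A"
    and "AE x in chacon_measure. S (chacon x) = chacon (S x)"
  shows "\<exists>k::int. AE x in chacon_measure. S x = chacon_power k x"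
proof -
  have space: "space chacon_measure = {0..}"
    by (simp add: chacon_measure_def space_restrict_space)
  have AE_iff: "(AE x in chacon_measure. P x) \<longleftrightarrow> (AE x in lborel. 0 \<le> x \<longrightarrow> P x)" for P
    unfolding chacon_measure_def by (subst AE_restrict_space_iff) auto
  \<comment> \<open>The values of \<open>S\<close> off the half-line are arbitrary; this version is Borel on the whole line.\<close>
  define S' where "S' x = (if x \<in> {0..} then S x else 0)" for x
  have nonneg: "0 \<le> S x" if "0 \<le> x" for x
    using measurable_space [OF assms(1), of x] that by (simp add: space)
  have "S \<in> measurable (restrict_space lborel {0..}) lborel"
    using assms(1) by (simp add: chacon_measure_def measurable_restrict_space2_iff)
  then have meas: "S' \<in> borel_measurable borel"
    unfolding S'_def by (subst (asm) measurable_restrict_space_iff [where c = 0]) auto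
  have "{0..<1} \<subseteq> {0::real..}" by auto
  have unit: "{0..<1} \<in> sets chacon_measure"
    unfolding chacon_measure_def by (subst sets_restrict_space_iff) auto
  have "emeasure chacon_measure (S -` {0..<1} \<inter> space chacon_measure) = emeasure chacon_measure {0..<1}"
    using assms(2) unit by blast
  also have "\<dots> = 1"
    using \<open>{0..<1} \<subseteq> {0..}\<close> by (simp add: chacon_measure_def emeasure_restrict_space)
  also have "S -` {0..<1} \<inter> space chacon_measure = {x. 0 \<le> x \<and> S' x < 1}"
  proof (rule set_eqI)
    fix x show "x \<in> S -` {0..<1} \<inter> space chacon_measure \<longleftrightarrow> x \<in> {x. 0 \<le> x \<and> S' x < 1}"
      using nonneg [of x] by (auto simp: space S'_def)
  qed
  also have "emeasure chacon_measure {x. 0 \<le> x \<and> S' x < 1} = emeasure lborel {x. 0 \<le> x \<and> S' x < 1}"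
    unfolding chacon_measure_def by (rule emeasure_restrict_space) auto
  finally have nonnull: "emeasure lborel {x. 0 \<le> x \<and> S' x < 1} \<noteq> 0" by simp
  have "AE x in lborel. 0 \<le> x \<longrightarrow> S' (chacon x) = chacon (S' x)"
    using assms(3) unfolding AE_iff by (rule AE_mp) (auto simp: S'_def chacon_nonneg)
  then obtain p q where "AE x in lborel. 0 \<le> x \<longrightarrow> (chacon ^^ p) (S' x) = (chacon ^^ q) x"
    using commuting_map_follows_orbits [OF meas _ nonnull] nonneg by (auto simp: S'_def)
  then have "AE x in lborel. 0 \<le> x \<longrightarrow> S x = chacon_power (int q - int p) x"
    by (rule AE_mp) (auto simp: S'_def intro!: chacon_power_eqI nonneg)
  then show ?thesis unfolding AE_iff by blast
qed

end
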